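(* Let $A,B\in\mathbb{Q}$ with $AB\neq 0$. (1) If $x^7+Ax+B$ has reducibility type $(3,4)$, then up to scaling $$A=\frac{(4u^2-5u+2)(u^3-u^2-2u+1)}{(2u-3)^2},\qquad B=\frac{(3u-1)(2u-1)(u-1)(u^2-u+1)}{(2u-3)^2}$$ for some $u\in\mathbb{Q}$, $u\neq1,\tfrac12,\tfrac13,\tfrac32$, with $$x^7+Ax+B=\left(x^3+x^2+ux+\frac{(3u-1)(u-1)}{2u-3}\right)\left(x^4-x^3-(u-1)x^2+\frac{u^2-4u+2}{2u-3}x+\frac{(2u-1)(u^2-u+1)}{2u-3}\right).$$ (2) There are no trinomials $x^7+Ax^2+B$ of reducibility type $(3,4)$. (3) If $x^7+Ax^3+B$ has reducibility type $(3,4)$, then up to scaling $(A,B)=(2,-1)$, with $$x^7+Ax^3+B=(x^3+x^2-1)(x^4-x^3+x^2+1).$$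
   Context: A monic polynomial in $\mathbb{Q}[x]$ has reducibility type $(n_1,\dots,n_k)$, $n_1\le\dots\le n_k$, if it factors as a product of $k$ irreducible polynomials in $\mathbb{Q}[x]$ (not necessarily distinct) of degrees $n_1,\dots,n_k$. Trinomials are considered up to scaling: $x^n+Ax^m+B$ and $x^n+A\lambda^{n-m}x^m+B\lambda^n$ are identified for $\lambda\in\mathbb{Q}\setminus\{0\}$; "up to scaling $(A,B)=(A_0,B_0)$" means $(A,B)=(A_0\lambda^{n-m},B_0\lambda^n)$ for some $\lambda\in\mathbb{Q}\setminus\{0\}$ (and the factorization is that of the scaled trinomial). *)

theory Defs
  imports "HOL-Computational_Algebra.Computational_Algebra"
begin

text \<open>The list enumerates the degrees of the irreducible factors in non-decreasing order; factors
  may repeat.\<close>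

definition has_reducibility_type :: "rat poly \<Rightarrow> nat list \<Rightarrow> bool" where
  "has_reducibility_type p ns \<longleftrightarrow>
     lead_coeff p = 1 \<and> sorted ns \<and>
     (\<exists>fs. (\<forall>f\<in>set fs. irreducible f) \<and> map degree fs = ns \<and> p = prod_list fs)"

definition trinomial :: "nat \<Rightarrow> nat \<Rightarrow> rat \<Rightarrow> rat \<Rightarrow> rat poly" where
  "trinomial n m A B = monom 1 n + monom A m + monom B 0"

text \<open>Equality of the coefficient pairs \<open>(A, B)\<close> and \<open>(A0, B0)\<close> up to scaling depends on the
  exponents \<open>n > m\<close> of the trinomial \<open>x^n + A x^m + B\<close>.\<close>

definition eq_up_to_scaling :: "nat \<Rightarrow> nat \<Rightarrow> rat \<times> rat \<Rightarrow> rat \<times> rat \<Rightarrow> bool" where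
  "eq_up_to_scaling n m = (\<lambda>(A, B) (A0, B0).
     \<exists>l. l \<noteq> 0 \<and> A = A0 * l ^ (n - m) \<and> B = B0 * l ^ n)"

end

theory Submission
  imports Defs
begin

text \<open>Write the factors as \<open>x\<^sup>3 + a x\<^sup>2 + b x + c\<close> and \<open>x\<^sup>4 - a x\<^sup>3 + d x\<^sup>2 + e x + h\<close>. Three of the vanishing
  coefficients of the product determine \<open>d\<close>, \<open>e\<close>, \<open>h\<close>, and scaling allows \<open>a = 1\<close> unless \<open>a = 0\<close>. The last
  vanishing coefficient is then a plane curve in \<open>(b, c)\<close>. For \<open>x\<^sup>7 + A x + B\<close> it is linear in \<open>c\<close>, which
  gives the rational family. For \<open>x\<^sup>7 + A x\<^sup>2 + B\<close> it is the elliptic curve \<open>v (v + 1 - 2 b) = b\<^sup>3\<close> of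
  conductor 35 and rank 0; a descent through the 3-isogenous curve \<open>X\<^sup>3 + Y\<^sup>3 + Z\<^sup>3 + 2 X Y Z = 0\<close> shows
  that \<open>b = 0\<close> on it, and in the remaining cases the quartic factor has a rational root. For
  \<open>x\<^sup>7 + A x\<^sup>3 + B\<close> it is a curve of conductor 14 and rank 0 with a rational 2-torsion point; a
  2-isogeny descent leaves six points, of which only \<open>b = 0\<close>, \<open>c = - 1\<close> gives irreducible factors.\<close>

subsection \<open>Eisenstein integers\<close>

text \<open>One half of the 3-descent is cheap: coprime \<open>P\<close>, \<open>Q\<close>,
  \<open>R\<close> with \<open>P Q R = T^3\<close> are cubes, which gives the cubic in
  \<open>X\<close>, \<open>Y\<close>, \<open>Z\<close>. The way back is the obstacle: two of the
  three flexes on \<open>Z = 0\<close> are conjugate over Q(\<omega>), so the factorization takes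
  place in Z[\<omega>] and needs a Euclidean algorithm there. The bad primes 5 and 7 govern the
  possible covers: 5 is inert and must divide the rational tangent, whereas 7 splits, and the cyclic
  symmetry of the cubic is used to choose a tangent that it divides. The 2-isogeny descent stays in
  the integers; completing a square twice returns the same quartic in smaller variables, and
  congruences modulo powers of 2 discard the other covers. One quartic has the solution
  \<open>m = n = 1\<close>, so that descent stops at a fixed point instead of a
  contradiction.\<close>

text \<open>\<open>Eis a b\<close> stands for \<open>a + b \<omega>\<close> with \<open>\<omega>\<^sup>2 + \<omega> + 1 = 0\<close>.\<close>

datatype eisenstein = Eis int int

instantiation eisenstein :: comm_ring_1
begin

definition "0 = Eis 0 0"
definition "1 = Eis 1 0"
fun plus_eisenstein where "Eis a b + Eis c d = Eis (a + c) (b + d)"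
fun minus_eisenstein where "Eis a b - Eis c d = Eis (a - c) (b - d)"
fun uminus_eisenstein where "- Eis a b = Eis (- a) (- b)"
fun times_eisenstein where "Eis a b * Eis c d = Eis (a * c - b * d) (a * d + b * c - b * d)"

instance
proof
  fix x y z :: eisenstein
  show "x + y + z = x + (y + z)" by (cases x; cases y; cases z) simp
  show "x + y = y + x" by (cases x; cases y) simp
  show "0 + x = x" by (cases x) (simp add: zero_eisenstein_def)
  show "- x + x = 0" by (cases x) (simp add: zero_eisenstein_def)
  show "x - y = x + - y" by (cases x; cases y) simp
  show "x * y * z = x * (y * z)" by (cases x; cases y; cases z) (simp add: algebra_simps)
  show "x * y = y * x" by (cases x; cases y) (simp add: algebra_simps)
  show "1 * x = x" by (cases x) (simp add: one_eisenstein_def)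
  show "(x + y) * z = x * z + y * z" by (cases x; cases y; cases z) (simp add: algebra_simps)
  show "(0 :: eisenstein) \<noteq> 1" by (simp add: zero_eisenstein_def one_eisenstein_def)
qed

end

fun eis_norm :: "eisenstein \<Rightarrow> int" where
  "eis_norm (Eis a b) = a\<^sup>2 - a * b + b\<^sup>2"

lemma eis_norm_mult: "eis_norm (x * y) = eis_norm x * eis_norm y"
  by (cases x; cases y) (simp add: algebra_simps power2_eq_square)

lemma eis_norm_power: "eis_norm (x ^ n) = eis_norm x ^ n"
  by (induction n) (simp_all add: eis_norm_mult one_eisenstein_def)

lemma eis_norm_form: "4 * (a\<^sup>2 - a * b + b\<^sup>2) = (2 * a - b)\<^sup>2 + 3 * (b :: int)\<^sup>2"
  by (simp add: algebra_simps power2_eq_square)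

lemma eis_norm_nonneg: "eis_norm x \<ge> 0"
proof (cases x)
  case (Eis a b)
  show ?thesis using eis_norm_form[of a b] by (simp add: Eis) (smt (verit) zero_le_power2)
qed

lemma eis_norm_eq_0_iff: "eis_norm x = 0 \<longleftrightarrow> x = 0"
proof (cases x)
  case (Eis a b)
  have "a = 0 \<and> b = 0" if "a\<^sup>2 - a * b + b\<^sup>2 = 0"
  proof -
    have "(2 * a - b)\<^sup>2 + 3 * b\<^sup>2 = 0" using eis_norm_form[of a b] that by simp
    then have "b\<^sup>2 = 0 \<and> (2 * a - b)\<^sup>2 = 0" by (smt (verit) zero_le_power2)
    then show ?thesis by simp
  qed
  then show ?thesis by (auto simp: Eis zero_eisenstein_def)
qed

text \<open>The cofactor of \<open>x - y\<close> in \<open>x^3 - y^3\<close> is the norm of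
  \<open>Eis x (- y)\<close>, which vanishes only at 0.\<close>

lemma int_cube_eq_iff: "x ^ 3 = y ^ 3 \<longleftrightarrow> x = (y :: int)"
proof
  assume "x ^ 3 = y ^ 3"
  moreover have "(x - y) * eis_norm (Eis x (- y)) = x ^ 3 - y ^ 3"
    by (simp add: algebra_simps power2_eq_square power3_eq_cube)
  ultimately have "x = y \<or> Eis x (- y) = 0"
    by (metis diff_self eis_norm_eq_0_iff eq_iff_diff_eq_0 mult_eq_0_iff)
  then show "x = y" by (auto simp: zero_eisenstein_def)
qed simp

lemma int_nearest_quotient:
  fixes x n :: int
  assumes "n > 0"
  shows "\<exists>q. 2 * \<bar>x - q * n\<bar> \<le> n"
proof -
  have "2 * x + n = (2 * n) * ((2 * x + n) div (2 * n)) + (2 * x + n) mod (2 * n)" by simp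
  moreover have "0 \<le> (2 * x + n) mod (2 * n)" "(2 * x + n) mod (2 * n) < 2 * n"
    using assms by simp_all
  ultimately have "2 * \<bar>x - ((2 * x + n) div (2 * n)) * n\<bar> \<le> n"
    by (simp add: abs_if algebra_simps)
  then show ?thesis by blast
qed

text \<open>Rounding errors of at most 1/2 in both coordinates have norm at most 3/4; this makes the
  ring Euclidean.\<close>

lemma eis_norm_less:
  fixes x y n :: int
  assumes "n > 0" "2 * \<bar>x\<bar> \<le> n" "2 * \<bar>y\<bar> \<le> n"
  shows "x\<^sup>2 - x * y + y\<^sup>2 < n * n"
proof -
  have "(2 * \<bar>x\<bar>) * (2 * \<bar>x\<bar>) \<le> n * n" "(2 * \<bar>y\<bar>) * (2 * \<bar>y\<bar>) \<le> n * n"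
    "(2 * \<bar>x\<bar>) * (2 * \<bar>y\<bar>) \<le> n * n"
    using assms by (intro mult_mono; simp)+
  moreover have "n * n > 0" using assms by simp
  moreover have "- (x * y) \<le> \<bar>x\<bar> * \<bar>y\<bar>" by (simp add: abs_mult[symmetric])
  ultimately show ?thesis by (simp add: power2_eq_square)
qed

lemma eis_division:
  assumes "b \<noteq> 0"
  shows "\<exists>q. eis_norm (a - q * b) < eis_norm b"
proof -
  obtain c d where b: "b = Eis c d" by (cases b)
  define b' where "b' = Eis (c - d) (- d)"
  define n where "n = eis_norm b"
  have n: "n > 0" using assms eis_norm_nonneg[of b] eis_norm_eq_0_iff[of b] unfolding n_def by simp
  have bb: "b * b' = Eis n 0" by (simp add: b b'_def n_def algebra_simps power2_eq_square)
  have nb': "eis_norm b' = n" by (simp add: b b'_def n_def algebra_simps power2_eq_square)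
  obtain x y where xy: "a * b' = Eis x y" by (cases "a * b'")
  obtain q1 q2 where q: "2 * \<bar>x - q1 * n\<bar> \<le> n" "2 * \<bar>y - q2 * n\<bar> \<le> n"
    using int_nearest_quotient[OF n] by metis
  have "(a - Eis q1 q2 * b) * b' = a * b' - Eis q1 q2 * (b * b')" by (simp add: algebra_simps)
  also have "\<dots> = Eis (x - q1 * n) (y - q2 * n)" by (simp add: xy bb)
  finally have "eis_norm (a - Eis q1 q2 * b) * n < n * n"
    using eis_norm_less[OF n q] by (metis eis_norm.simps eis_norm_mult nb')
  then show ?thesis using n unfolding n_def by (metis mult_less_cancel_right_pos)
qed

text \<open>The Euclidean algorithm carries the cofactors \<open>a'\<close>, \<open>b'\<close> along
  with the Bezout coefficients; these identities are what the ideal computation with cubes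
  needs.\<close>

lemma eis_bezout: "\<exists>g x y a' b'. g = x * a + y * b \<and> a = g * a' \<and> b = g * (b' :: eisenstein)"
proof (induction "nat (eis_norm b)" arbitrary: a b rule: less_induct)
  case less
  show ?case
  proof (cases "b = 0")
    case True
    then have "a = 1 * a + 0 * b \<and> a = a * 1 \<and> b = a * 0" by simp
    then show ?thesis by blast
  next
    case False
    obtain q where q: "eis_norm (a - q * b) < eis_norm b" using eis_division[OF False] by blast
    then have "nat (eis_norm (a - q * b)) < nat (eis_norm b)"
      using eis_norm_nonneg[of "a - q * b"] by simp
    from less[OF this, of b] obtain g x y a' b' where
      g: "g = x * b + y * (a - q * b)" "b = g * a'" "a - q * b = g * b'" by blast
    have "g = y * a + (x - y * q) * b" using g(1) by (simp add: algebra_simps)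
    moreover have "a = g * (b' + q * a')"
    proof -
      have "a = (a - q * b) + q * b" by simp
      also have "\<dots> = g * b' + q * (g * a')" using g(2,3) by simp
      finally show ?thesis by (simp add: algebra_simps)
    qed
    ultimately show ?thesis using g(2) by blast
  qed
qed

text \<open>With \<open>g\<close> a greatest common divisor of \<open>a\<close> and \<open>s\<close>, the ideal \<open>(a, s)\<^sup>3\<close> equals
  \<open>a (a\<^sup>2, a s, s\<^sup>2, b) = (a)\<close>.\<close>

lemma eis_coprime_cube:
  fixes a b s :: eisenstein
  assumes "x * a + y * b = 1" "a * b = s ^ 3"
  shows "\<exists>g e d. a = e * g ^ 3 \<and> g ^ 3 = d * a"
proof -
  obtain g p q a' s' where g: "g = p * a + q * s" "a = g * a'" "s = g * s'"
    using eis_bezout[of a s] by blast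
  have "g ^ 3 = p ^ 3 * a ^ 3 + 3 * p ^ 2 * q * a ^ 2 * s + 3 * p * q ^ 2 * a * s ^ 2 + q ^ 3 * s ^ 3"
    by (simp add: g(1) algebra_simps power3_eq_cube power2_eq_square)
  also have "\<dots> = (p ^ 3 * a ^ 2 + 3 * p ^ 2 * q * a * s + 3 * p * q ^ 2 * s ^ 2 + q ^ 3 * b) * a"
    by (simp only: assms(2)[symmetric]) (simp add: algebra_simps power3_eq_cube power2_eq_square)
  finally have 1: "\<exists>d. g ^ 3 = d * a" by blast
  have "a = a * (x * a + y * b) ^ 2" by (simp add: assms(1))
  also have "\<dots> = a ^ 3 * x ^ 2 + (a * b) * (2 * x * y * a + y ^ 2 * b)"
    by (simp add: algebra_simps power3_eq_cube power2_eq_square)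
  also have "\<dots> = (g * a') ^ 3 * x ^ 2 + (g * s') ^ 3 * (2 * x * y * a + y ^ 2 * b)"
    using g(2,3) assms(2) by metis
  also have "\<dots> = (a' ^ 3 * x ^ 2 + s' ^ 3 * (2 * x * y * a + y ^ 2 * b)) * g ^ 3"
    by (simp add: algebra_simps power_mult_distrib)
  finally show ?thesis using 1 by blast
qed

lemma eis_unit_cases:
  fixes m n :: int
  assumes "m\<^sup>2 - m * n + n\<^sup>2 = 1"
  shows "(m, n) \<in> {(1,0), (-1,0), (0,1), (0,-1), (1,1), (-1,-1)}"
proof -
  have e: "(2 * m - n)\<^sup>2 + 3 * n\<^sup>2 = 4" "(2 * n - m)\<^sup>2 + 3 * m\<^sup>2 = 4"
    using assms by (simp_all add: algebra_simps power2_eq_square)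
  have small: "z \<in> {-1, 0, 1}" if "3 * z\<^sup>2 \<le> 4" for z :: int
  proof -
    have "z\<^sup>2 < 2\<^sup>2" using that by simp
    then have "\<bar>z\<bar> < 2" using abs_le_square_iff[of 2 z] by linarith
    then show ?thesis by auto
  qed
  have "3 * n\<^sup>2 \<le> 4" "3 * m\<^sup>2 \<le> 4" using e by (smt (verit) zero_le_power2)+
  then have "n \<in> {-1, 0, 1}" "m \<in> {-1, 0, 1}" by (simp_all only: small)
  then show ?thesis using assms by auto
qed

text \<open>The three alternatives are \<open>u + v \<omega> = \<omega>\<^sup>i (m + n \<omega>)\<^sup>3\<close> for \<open>i = 0, 1, 2\<close>.\<close>

lemma norm_form_cube:
  fixes u v s :: int
  assumes "coprime u v" "u\<^sup>2 - u * v + v\<^sup>2 = s ^ 3" "\<not> 3 dvd s"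
  obtains m n C D where
    "C = m ^ 3 - 3 * m * n\<^sup>2 + n ^ 3" "D = 3 * m * n * (m - n)"
    "(u, v) \<in> {(C, D), (- D, C - D), (D - C, - C)}" "s = m\<^sup>2 - m * n + n\<^sup>2"
proof -
  define a where "a = Eis u v"
  define b where "b = Eis (u - v) (- v)"
  have ab: "a * b = Eis s 0 ^ 3"
    using assms(2) by (simp add: a_def b_def power3_eq_cube power2_eq_square algebra_simps)
  have "coprime 3 (s ^ 3)" using assms(3) by (simp add: prime_imp_coprime)
  then obtain k l where kl: "k * 3 + l * s ^ 3 = 1" by (metis bezout_int coprime_imp_gcd_eq_1)
  obtain p q where pq: "p * u + q * v = 1" using assms(1) by (metis bezout_int coprime_imp_gcd_eq_1)
  \<comment> \<open>The ideal of \<open>a\<close> and its conjugate \<open>b\<close> contains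
    \<open>3 u\<close> and \<open>3 v\<close>, hence 3 because \<open>u\<close> and \<open>v\<close>
    are coprime. It also contains \<open>s^3 = a b\<close>, which is prime to 3, so it is the whole
    ring.\<close>
  have "(Eis 2 0 + Eis (- 1) (- 1)) * a + (Eis 2 0 + Eis 0 1) * b = Eis (3 * u) 0"
    "(Eis 1 0 + Eis (- 2) (- 2)) * a + (Eis 1 0 + Eis 0 2) * b = Eis (3 * v) 0"
    by (simp_all add: a_def b_def)
  then obtain x y x' y' where xy: "x * a + y * b = Eis (3 * u) 0" "x' * a + y' * b = Eis (3 * v) 0"
    by blast
  have "(1 :: eisenstein) = Eis (k * (3 * (p * u + q * v)) + l * s ^ 3) 0"
    using kl by (simp add: pq one_eisenstein_def)
  also have "\<dots> = Eis (k * p) 0 * Eis (3 * u) 0 + Eis (k * q) 0 * Eis (3 * v) 0 + Eis l 0 * Eis s 0 ^ 3"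
    by (simp add: algebra_simps power3_eq_cube)
  also have "\<dots> = (Eis (k * p) 0 * x + Eis (k * q) 0 * x' + Eis l 0 * b) * a
      + (Eis (k * p) 0 * y + Eis (k * q) 0 * y') * b"
    by (simp only: xy[symmetric] ab[symmetric]) (simp only: algebra_simps)
  finally obtain g e d where g: "a = e * g ^ 3" "g ^ 3 = d * a"
    using eis_coprime_cube[OF _ ab] by metis
  have Na: "eis_norm a = s ^ 3" using assms(2) by (simp add: a_def)
  then have "eis_norm a \<noteq> 0" using assms(3) by auto
  moreover have "eis_norm a = eis_norm e * eis_norm d * eis_norm a"
    using g by (metis eis_norm_mult mult.assoc)
  ultimately have "eis_norm e * eis_norm d = 1" by simp
  then have Ne: "eis_norm e = 1"
    using eis_norm_nonneg[of e] by (simp add: zmult_eq_1_iff)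
  obtain e1 e2 where e: "e = Eis e1 e2" by (cases e)
  obtain m n where mn: "g = Eis m n" by (cases g)
  have "s ^ 3 = eis_norm g ^ 3" using Na g(1) Ne by (simp add: eis_norm_mult eis_norm_power)
  then have s: "s = m\<^sup>2 - m * n + n\<^sup>2" by (simp only: int_cube_eq_iff mn eis_norm.simps)
  define C D where "C = m ^ 3 - 3 * m * n\<^sup>2 + n ^ 3" and "D = 3 * m * n * (m - n)"
  have g3: "g ^ 3 = Eis C D"
    by (simp add: mn C_def D_def power3_eq_cube power2_eq_square algebra_simps)
  have "Eis u v = Eis (e1 * C - e2 * D) (e1 * D + e2 * C - e2 * D)"
    using g(1) by (simp add: a_def e g3)
  moreover have "(e1, e2) \<in> {(1,0), (-1,0), (0,1), (0,-1), (1,1), (-1,-1)}"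
    using Ne unfolding e eis_norm.simps by (rule eis_unit_cases)
  \<comment> \<open>The unit -1 is a cube, so changing the signs of \<open>m\<close> and
    \<open>n\<close> reduces the second triple to the first; only powers of \<omega> remain.\<close>
  ultimately have "(u, v) \<in> {(C, D), (- D, C - D), (D - C, - C)}
      \<or> (u, v) \<in> {(- C, - D), (- (- D), - C - - D), (- D - - C, - (- C))}"
    by (elim insertE emptyE) simp_all
  then show ?thesis
  proof
    assume "(u, v) \<in> {(C, D), (- D, C - D), (D - C, - C)}"
    then show ?thesis by (rule that[OF C_def D_def _ s])
  next
    assume *: "(u, v) \<in> {(- C, - D), (- (- D), - C - - D), (- D - - C, - (- C))}"
    show ?thesis
    proof (rule that[OF _ _ * ])
      show "- C = (- m) ^ 3 - 3 * (- m) * (- n)\<^sup>2 + (- n) ^ 3" by (simp add: C_def)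
      show "- D = 3 * (- m) * (- n) * (- m - - n)" by (simp add: D_def algebra_simps)
      show "s = (- m)\<^sup>2 - (- m) * (- n) + (- n)\<^sup>2" by (simp add: s)
    qed
  qed
qed

subsection \<open>Descent by a 3-isogeny\<close>

text \<open>Absolute values bring the claim to natural numbers; the lost sign is harmless because -1
  is a cube.\<close>

lemma int_coprime_mult_cube:
  fixes a b c :: int
  assumes "coprime a b" "a * b = c ^ 3"
  obtains t where "a = t ^ 3"
proof -
  have eq: "nat \<bar>a\<bar> * nat \<bar>b\<bar> = nat \<bar>c\<bar> ^ 3"
    using arg_cong[OF assms(2), of "\<lambda>x. nat \<bar>x\<bar>"]
    by (simp add: abs_mult power_abs nat_mult_distrib nat_power_eq)
  moreover have "coprime (nat \<bar>a\<bar>) (nat \<bar>b\<bar>)" using assms(1) by simp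
  ultimately have "is_nth_power 3 (nat \<bar>a\<bar>)"
    using is_nth_power_mult_coprime_nat_iff[of "nat \<bar>a\<bar>" "nat \<bar>b\<bar>" 3] is_nth_power_nth_power[of 3 "nat \<bar>c\<bar>"]
    by simp
  then obtain k where k: "nat \<bar>a\<bar> = k ^ 3" by (elim is_nth_powerE)
  then have "\<bar>a\<bar> = int (k ^ 3)" by linarith
  then have "a = int k ^ 3 \<or> a = - (int k ^ 3)" by (simp add: abs_if split: if_splits)
  moreover have "- (int k ^ 3) = (- int k) ^ 3" by simp
  ultimately show ?thesis using that[of "int k"] that[of "- int k"] by argo
qed

text \<open>Modulo 7 the cubic splits, up to the unit -18, into three lines, the tangents at its
  rational flexes on \<open>Z = 0\<close>, \<open>X = 0\<close> and \<open>Y = 0\<close>. A cyclic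
  permutation of the coordinates therefore puts 7 into the tangent used in the descent.\<close>

lemma cubic_mod_7:
  fixes X Y Z :: int
  assumes "X ^ 3 + Y ^ 3 + Z ^ 3 + 2 * X * Y * Z = 0"
  shows "7 dvd 3 * X + 3 * Y - 2 * Z \<or> 7 dvd 3 * Y + 3 * Z - 2 * X \<or> 7 dvd 3 * Z + 3 * X - 2 * Y"
proof -
  have "(3 * X + 3 * Y - 2 * Z) * ((3 * Y + 3 * Z - 2 * X) * (3 * Z + 3 * X - 2 * Y)) =
      (- 18) * (X ^ 3 + Y ^ 3 + Z ^ 3 + 2 * X * Y * Z)
      + 7 * (3 * (X + Y + Z) * (X * Y + Y * Z + Z * X) - 5 * X * Y * Z)"
    by (simp add: algebra_simps power3_eq_cube)
  then have "7 dvd (3 * X + 3 * Y - 2 * Z) * ((3 * Y + 3 * Z - 2 * X) * (3 * Z + 3 * X - 2 * Y))"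
    using assms by simp
  then show ?thesis by (simp add: prime_dvd_mult_iff)
qed

lemma int_coprimeI_prime:
  fixes a b :: int
  assumes "\<And>p. prime p \<Longrightarrow> p dvd a \<Longrightarrow> p dvd b \<Longrightarrow> False"
  shows "coprime a b"
proof (rule ccontr)
  assume nc: "\<not> coprime a b"
  then have u: "\<not> is_unit (gcd a b)" by (metis is_unit_gcd)
  show False
  proof (cases "gcd a b = 0")
    case True
    then show False using assms[of 2] by (simp add: gcd_eq_0_iff)
  next
    case False
    then obtain p where "p dvd gcd a b" "prime p" using u prime_divisor_exists by blast
    then show False using assms by (meson dvd_trans gcd_dvd1 gcd_dvd2)
  qed
qed

text \<open>Since -3 is not a square modulo 5, the norm form is anisotropic there; residues of least
  absolute value leave a finite check.\<close>

lemma norm_form_5: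
  fixes u v :: int
  assumes "5 dvd u\<^sup>2 - u * v + v\<^sup>2"
  shows "5 dvd u \<and> 5 dvd v"
proof -
  have "\<exists>k r. x = 5 * k + r \<and> r \<in> {-2, -1, 0, 1, 2}" for x :: int
  proof -
    have "x = 5 * ((x + 2) div 5) + ((x + 2) mod 5 - 2)"
      using mult_div_mod_eq[of 5 "x + 2"] by linarith
    moreover have "0 \<le> (x + 2) mod 5" "(x + 2) mod 5 < 5" by simp_all
    then have "(x + 2) mod 5 - 2 \<in> {-2, -1, 0, 1, 2}" by (simp only: insert_iff empty_iff) linarith
    ultimately show ?thesis by blast
  qed
  then obtain k r l s where uv: "u = 5 * k + r" "v = 5 * l + s"
    and rs: "r \<in> {-2, -1, 0, 1, 2}" "s \<in> {-2, -1, 0, 1, 2}" by metis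
  have eq: "r\<^sup>2 - r * s + s\<^sup>2 = (u\<^sup>2 - u * v + v\<^sup>2)
      - 5 * (5 * k\<^sup>2 + 2 * k * r - 5 * k * l - k * s - l * r + 5 * l\<^sup>2 + 2 * l * s)"
    by (simp add: uv algebra_simps power2_eq_square)
  have "5 dvd r\<^sup>2 - r * s + s\<^sup>2" by (subst eq) (intro dvd_diff assms dvd_triv_left)
  then have "r = 0 \<and> s = 0" using rs by (elim insertE emptyE) simp_all
  then show ?thesis by (simp add: uv)
qed

text \<open>The tangents \<open>F\<^sub>i = 3 X + 3 \<omega>\<^sup>2\<^sup>i Y - 2 \<omega>\<^sup>i Z\<close> at the flexes on the line \<open>Z = 0\<close> satisfy
  \<open>F\<^sub>0 F\<^sub>1 F\<^sub>2 = - 35 Z\<^sup>3\<close> on the curve, where \<open>F\<^sub>1\<close> and \<open>F\<^sub>2\<close> are conjugate. The prime 5 is inert, hence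
  divides \<open>F\<^sub>0\<close>; by assumption 7 divides \<open>F\<^sub>0\<close>, too. So \<open>F\<^sub>0 = 35 t\<^sup>3\<close> and, up to a unit, \<open>F\<^sub>1\<close> is the cube
  of some \<open>m + n \<omega>\<close>; the unit is determined modulo 3. If \<open>3 dvd Z\<close>, the factors are not coprime and
  \<open>3 (1 - \<omega>)\<close> has to be split off from \<open>F\<^sub>1\<close> first. The equation for \<open>t, m, n\<close> is
  \<open>F\<^sub>0 + \<omega>\<^sup>2 F\<^sub>1 + \<omega> F\<^sub>2 = - 6 Z\<close>.\<close>

lemma tangent_descent:
  fixes X Y Z :: int
  assumes curve: "X ^ 3 + Y ^ 3 + Z ^ 3 + 2 * X * Y * Z = 0"
    and XZ: "coprime X Z" and YZ: "coprime Y Z" and seven: "7 dvd 3 * X + 3 * Y - 2 * Z"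
  obtains t m n where
    "35 * t ^ 3 + (2 * m - n) * (m + n) * (m - 2 * n) = 6 * t * (m\<^sup>2 - m * n + n\<^sup>2)"
    "t * (m\<^sup>2 - m * n + n\<^sup>2) = - Z"
proof -
  define F where "F = 3 * X + 3 * Y - 2 * Z"
  \<comment> \<open>\<open>u + v \<omega>\<close> is the tangent \<open>F\<^sub>1\<close>, so its
    norm \<open>N\<close> is \<open>F\<^sub>1 F\<^sub>2\<close>.\<close>
  define u v where "u = 3 * X - 3 * Y" and "v = - (3 * Y + 2 * Z)"
  define N where "N = u\<^sup>2 - u * v + v\<^sup>2"
  have N: "N = 9 * (X + Y)\<^sup>2 - 27 * (X * Y) + 4 * Z\<^sup>2 + 6 * Z * (X + Y)"
    by (simp add: N_def u_def v_def algebra_simps power2_eq_square)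
  have noX: False if "prime p" "p dvd X" "p dvd Z" for p
    using that XZ by (meson coprime_common_divisor not_prime_unit)
  have noY: False if "prime p" "p dvd Y" "p dvd Z" for p
    using that YZ by (meson coprime_common_divisor not_prime_unit)
  have noXY: False if "prime p" "p dvd X * Y" "p dvd Z" for p
    using that noX noY prime_dvd_mult_iff by blast
  have FN: "F * N = - 35 * Z ^ 3"
  proof -
    have "F * N + 35 * Z ^ 3 = 27 * (X ^ 3 + Y ^ 3 + Z ^ 3 + 2 * X * Y * Z)"
      by (simp add: F_def N algebra_simps power3_eq_cube power2_eq_square)
    then show ?thesis unfolding curve by linarith
  qed
  have "5 dvd F"
  proof (rule ccontr)
    \<comment> \<open>Then 5 divides the norm \<open>N\<close>, hence both coordinates, hence 25
      divides \<open>N\<close> and \<open>35 Z^3\<close>; so 5 divides \<open>Z\<close> and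
      \<open>Y\<close>.\<close>
    assume "\<not> 5 dvd F"
    moreover have "F * N = 5 * (- 7 * Z ^ 3)" using FN by linarith
    then have "5 dvd F * N" by (rule dvdI)
    ultimately have "5 dvd N" using prime_dvd_multD[of "5 :: int" F N] by simp
    then have uv: "5 dvd u" "5 dvd v" using norm_form_5[of u v] by (simp_all only: N_def)
    then obtain u' v' where "u = 5 * u'" "v = 5 * v'" by (elim dvdE)
    then have "N = 25 * (u'\<^sup>2 - u' * v' + v'\<^sup>2)" by (simp add: N_def power2_eq_square)
    then obtain W where "N = 25 * W" by blast
    then have "25 * (F * W) = - 35 * Z ^ 3" using FN by simp
    then have "7 * Z ^ 3 = 5 * (- (F * W))" by linarith
    then have "5 dvd 7 * Z ^ 3" by (rule dvdI)
    then have "5 dvd Z ^ 3" using prime_dvd_multD[of "5 :: int" 7 "Z ^ 3"] by simp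
    then have Z: "5 dvd Z" using prime_dvd_power[of "5 :: int"] by simp
    have "3 * Y = - v - 2 * Z" by (simp add: v_def)
    then have "5 dvd 3 * Y" using uv Z by simp
    then have "5 dvd Y" by presburger
    then show False using noY[of 5] Z by simp
  qed
  moreover have "7 dvd F" using seven by (simp only: F_def)
  ultimately have "35 dvd F" by presburger
  then obtain f where f: "F = 35 * f" by (elim dvdE)
  have "f * N = - (Z ^ 3)" using FN unfolding f by linarith
  then have fN: "f * N = (- Z) ^ 3" by simp
  show ?thesis
  proof (cases "3 dvd Z")
    case False
    have "coprime f N"
    proof (rule int_coprimeI_prime)
      fix p :: int assume p: "prime p" "p dvd f" "p dvd N"
      then have "p dvd (- Z) ^ 3" by (simp add: fN[symmetric])
      then have pZ: "p dvd Z" using prime_dvd_power[OF p(1), of "- Z" 3] by simp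
      have p3: "\<not> p dvd 3" using False pZ p(1) primes_dvd_imp_eq[of p 3] by auto
      have "3 * (X + Y) = 35 * f + 2 * Z" using f by (simp add: F_def)
      then have "p dvd 3 * (X + Y)" using p pZ by simp
      then have "p dvd X + Y" using p(1) p3 prime_dvd_multD by blast
      moreover have "3 * (3 * (3 * (X * Y))) = 9 * (X + Y)\<^sup>2 + 4 * Z\<^sup>2 + 6 * Z * (X + Y) - N"
        using N by simp
      ultimately have "p dvd 3 * (3 * (3 * (X * Y)))" using p(3) pZ by (simp add: power2_eq_square)
      then show False using p3 p(1) noXY pZ by (metis prime_dvd_mult_iff)
    qed
    then have "coprime N f" by (simp add: coprime_commute)
    moreover have "N * f = (- Z) ^ 3" by (subst mult.commute) (rule fN)
    ultimately obtain s where s: "N = s ^ 3" by (rule int_coprime_mult_cube)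
    obtain t where t: "f = t ^ 3" using \<open>coprime f N\<close> fN by (rule int_coprime_mult_cube)
    have "(t * s) ^ 3 = (- Z) ^ 3" using t s fN by (simp add: power_mult_distrib)
    then have ts: "t * s = - Z" by (simp only: int_cube_eq_iff)
    then have sZ: "s dvd Z" by (metis dvd_minus_iff dvd_triv_right)
    then have s3: "\<not> 3 dvd s" using False dvd_trans by blast
    have "coprime u v"
    proof (rule int_coprimeI_prime)
      fix p :: int assume p: "prime p" "p dvd u" "p dvd v"
      then have "p dvd s ^ 3" unfolding s[symmetric] N_def by (simp add: power2_eq_square)
      then have pZ: "p dvd Z" using p(1) prime_dvd_power sZ dvd_trans by blast
      have p3: "\<not> p dvd 3" using False pZ p(1) primes_dvd_imp_eq[of p 3] by auto
      have "3 * Y = - v - 2 * Z" by (simp add: v_def)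
      then have "p dvd 3 * Y" using p pZ by simp
      then show False using p3 p(1) noY pZ by (metis prime_dvd_mult_iff)
    qed
    then obtain m n C D where
      C: "C = m ^ 3 - 3 * m * n\<^sup>2 + n ^ 3" and D: "D = 3 * m * n * (m - n)"
      and uv: "(u, v) \<in> {(C, D), (- D, C - D), (D - C, - C)}" and smn: "s = m\<^sup>2 - m * n + n\<^sup>2"
      by (rule norm_form_cube[OF _ s[unfolded N_def] s3])
    have D3: "3 dvd D" by (simp add: D mult.assoc)
    have "\<not> 3 dvd C"
    proof
      assume "3 dvd C"
      then have "3 dvd u \<and> 3 dvd v" using uv D3 by auto
      then have "3 dvd N" by (simp add: N_def power2_eq_square)
      then show False using s3 s prime_dvd_power[of "3 :: int" s 3] by simp
    qed
    moreover have "3 dvd u" by (simp add: u_def)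
    moreover have "3 dvd D - C \<longleftrightarrow> 3 dvd C" using D3 by (metis dvd_diff_right_iff)
    ultimately have uvD: "u = - D" "v = C - D" using uv by auto
    have "2 * C - D = u + 2 * v - u - u" using uvD by simp
    then have "35 * t ^ 3 + (2 * C - D) = 6 * t * s"
      using f t ts by (simp add: F_def u_def v_def)
    moreover have "2 * C - D = (2 * m - n) * (m + n) * (m - 2 * n)"
      by (simp add: C D algebra_simps power3_eq_cube power2_eq_square)
    ultimately show ?thesis using that[of t m n] ts smn by simp
  next
    case True
    then obtain z' where z': "Z = 3 * z'" by (elim dvdE)
    have XY3: "\<not> 3 dvd X * Y" using noXY[of 3] True by auto
    \<comment> \<open>Modulo 3 the curve forces \<open>3 dvd X + Y\<close>; substituted back, modulo
      9 it forces \<open>9 dvd Z\<close>.\<close>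
    have "(X + Y) ^ 3 = (X ^ 3 + Y ^ 3 + Z ^ 3 + 2 * X * Y * Z)
        + 3 * (X * Y * (X + Y) - 9 * z' ^ 3 - 2 * X * Y * z')"
      by (simp add: z' algebra_simps power3_eq_cube)
    then have "3 dvd (X + Y) ^ 3" using curve by simp
    then have "3 dvd X + Y" using prime_dvd_power[of "3 :: int"] by simp
    then obtain k where "X + Y = 3 * k" by (elim dvdE)
    then have k: "X = 3 * k - Y" by simp
    obtain w where w: "w = 3 * k ^ 3 - k * X * Y + 3 * z' ^ 3" by blast
    have "6 * (z' * (X * Y)) = (X ^ 3 + Y ^ 3 + Z ^ 3 + 2 * X * Y * Z) - 9 * w"
      by (simp add: w k z' algebra_simps power3_eq_cube)
    then have "6 * (z' * (X * Y)) = - 9 * w" unfolding curve by simp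
    then have "z' * (X * Y) = 3 * (z' * (X * Y) + w)" by presburger
    then have "3 dvd z' * (X * Y)" by (rule dvdI)
    then have "3 dvd z'" using XY3 prime_dvd_multD[of "3 :: int" z' "X * Y"] by simp
    then obtain z where "z' = 3 * z" by (elim dvdE)
    then have z: "Z = 9 * z" using z' by simp
    define M where "M = 3 * k\<^sup>2 - X * Y + 12 * z\<^sup>2 + 6 * z * k"
    have M3: "\<not> 3 dvd M"
    proof
      assume "3 dvd M"
      moreover have "X * Y = 3 * (k\<^sup>2 + 4 * z\<^sup>2 + 2 * z * k) - M" by (simp add: M_def)
      ultimately show False using XY3 by simp
    qed
    have NM: "N = 27 * M"
      by (simp add: N M_def k z algebra_simps power2_eq_square)
    have "9 * k - 18 * z = 3 * (3 * k - Y) + 3 * Y - 2 * (9 * z)" by simp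
    also have "\<dots> = F" unfolding F_def k z ..
    also note f
    finally have kf9: "9 * k - 18 * z = 35 * f" .
    \<comment> \<open>This is \<open>f / 9\<close> without a division, since
      \<open>9 * k - 18 * z = 35 * f\<close> and 36 - 35 = 1.\<close>
    define f' where "f' = 4 * f - k + 2 * z"
    have "9 * f' = 36 * f - (9 * k - 18 * z)" by (simp add: f'_def)
    then have f': "f = 9 * f'" unfolding kf9 by simp
    have "9 * (k - 2 * z) = 9 * (35 * f')" using kf9 unfolding f' by simp
    then have kf: "k - 2 * z = 35 * f'" unfolding mult_cancel_left by simp
    have "243 * (f' * M) = - (729 * z ^ 3)" using fN by (simp add: f' NM z power_mult_distrib)
    then have f'M: "f' * M = 3 * (- (z ^ 3))" by linarith
    then have "3 dvd f' * M" by (rule dvdI)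
    then have "3 dvd f'" using M3 prime_dvd_multD[of "3 :: int" f' M] by simp
    then obtain h where h: "f' = 3 * h" by (elim dvdE)
    have "3 * (h * M) = 3 * (- (z ^ 3))" using f'M unfolding h mult.assoc .
    then have "h * M = - (z ^ 3)" by linarith
    then have hM: "h * M = (- z) ^ 3" by simp
    have zZ: "p dvd Z" if "p dvd z" for p unfolding z using that by (rule dvd_mult)
    have "coprime h M"
    proof (rule int_coprimeI_prime)
      fix p :: int assume p: "prime p" "p dvd h" "p dvd M"
      then have "p dvd (- z) ^ 3" by (simp add: hM[symmetric])
      then have pz: "p dvd z" using prime_dvd_power[OF p(1), of "- z" 3] by simp
      have "k = 2 * z + 35 * (3 * h)" using kf h by simp
      then have "p dvd k" using pz p by simp
      moreover have "X * Y = 3 * k\<^sup>2 + 12 * z\<^sup>2 + 6 * z * k - M" by (simp add: M_def)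
      ultimately have "p dvd X * Y" using p pz by (simp add: power2_eq_square)
      then show False using noXY p(1) zZ pz by blast
    qed
    then have "coprime M h" by (simp add: coprime_commute)
    moreover have "M * h = (- z) ^ 3" by (subst mult.commute) (rule hM)
    ultimately obtain s where s: "M = s ^ 3" by (rule int_coprime_mult_cube)
    obtain t where t: "h = t ^ 3" using \<open>coprime h M\<close> hM by (rule int_coprime_mult_cube)
    have "(t * s) ^ 3 = (- z) ^ 3" using t s hM by (simp add: power_mult_distrib)
    then have ts: "t * s = - z" by (simp only: int_cube_eq_iff)
    then have sz: "s dvd z" by (metis dvd_minus_iff dvd_triv_right)
    have s3: "\<not> 3 dvd s" using M3 s by auto
    \<comment> \<open>\<open>3 (1 - \<omega>) (x + y \<omega>) = u + v \<omega>\<close>, so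
      \<open>x + y \<omega>\<close> is what is left of \<open>F\<^sub>1\<close>, and
      \<open>M\<close> is its norm.\<close>
    define x y where "x = 2 * k - Y + 2 * z" and "y = k - Y - 2 * z"
    have xy: "x\<^sup>2 - x * y + y\<^sup>2 = s ^ 3"
      unfolding s[symmetric] by (simp add: x_def y_def M_def k algebra_simps power2_eq_square)
    have "coprime x y"
    proof (rule int_coprimeI_prime)
      fix p :: int assume p: "prime p" "p dvd x" "p dvd y"
      then have "p dvd s ^ 3" unfolding xy[symmetric] by (simp add: power2_eq_square)
      then have pz: "p dvd z" using p(1) prime_dvd_power sz dvd_trans by blast
      have "Y = x - 2 * y - 6 * z" by (simp add: x_def y_def)
      then have "p dvd Y" using p pz by simp
      then show False using noY p(1) zZ pz by blast
    qed
    then obtain m n C D where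
      C: "C = m ^ 3 - 3 * m * n\<^sup>2 + n ^ 3" and D: "D = 3 * m * n * (m - n)"
      and uv: "(x, y) \<in> {(C, D), (- D, C - D), (D - C, - C)}" and smn: "s = m\<^sup>2 - m * n + n\<^sup>2"
      by (rule norm_form_cube[OF _ xy s3])
    have D3: "3 dvd D" by (simp add: D mult.assoc)
    have Y3: "\<not> 3 dvd Y" using XY3 by auto
    \<comment> \<open>Both coordinates are \<open>- Y\<close> modulo 3, hence prime to 3, while
      \<open>3 dvd D\<close>; this leaves only the third unit.\<close>
    have "x = 3 * (2 * z + 70 * h) - Y" "y = 3 * (35 * h) - Y"
      using kf h by (simp_all add: x_def y_def)
    then have "\<not> 3 dvd x" "\<not> 3 dvd y" using Y3 by (metis dvd_diff_right_iff dvd_triv_left)+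
    then have "x = D - C" "y = - C" using uv D3 by auto
    then have "D = k + 4 * z" by (simp add: x_def y_def)
    then have "35 * (3 * t) ^ 3 + (- 9 * D) = 6 * (3 * t) * (3 * s)"
      using kf ts by (simp add: power_mult_distrib t[symmetric] h algebra_simps)
    \<comment> \<open>The new pair is \<open>(\<omega> - 1) (m + n \<omega>) = - (m + n) + (m - 2 n)
      \<omega>\<close>: the prime above 3 is put back so that both cases end in the same equation,
      with \<open>3 t\<close> for \<open>t\<close>.\<close>
    moreover have "- 9 * D = (2 * - (m + n) - (m - 2 * n)) * (- (m + n) + (m - 2 * n)) * (- (m + n) - 2 * (m - 2 * n))"
      by (simp add: D algebra_simps power2_eq_square)
    moreover have "3 * s = (- (m + n))\<^sup>2 - (- (m + n)) * (m - 2 * n) + (m - 2 * n)\<^sup>2"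
      by (simp add: smn algebra_simps power2_eq_square)
    moreover have "3 * t * (3 * s) = - Z" using ts z by simp
    ultimately show ?thesis by (intro that[of "3 * t" "- (m + n)" "m - 2 * n"]) argo+
  qed
qed

text \<open>The numbers \<open>2 m - n\<close>, \<open>- (m + n)\<close>, \<open>2 n - m\<close>
  have sum 0, second symmetric function \<open>- 3 (m^2 - m n + n^2)\<close> and the product that
  occurs in the equation for \<open>t\<close>. Shifting each by \<open>2 t\<close> gives product
  \<open>- 27 t^3\<close> and sum \<open>6 t\<close>. The shifted numbers agree modulo 3, so 3
  divides all of them, which leads back to the equations in \<open>P\<close>, \<open>Q\<close>,
  \<open>R\<close>.\<close>

lemma descent_step:
  fixes X Y Z :: int
  assumes curve: "X ^ 3 + Y ^ 3 + Z ^ 3 + 2 * X * Y * Z = 0"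
    and "coprime X Z" "coprime Y Z" "X \<noteq> 0" "Y \<noteq> 0" "Z \<noteq> 0" "7 dvd 3 * X + 3 * Y - 2 * Z"
  obtains P Q R T :: int where "P * Q * R = T ^ 3" "P + Q + R = - 2 * T" "T \<noteq> 0" "\<bar>T\<bar> < \<bar>X * Y * Z\<bar>"
proof -
  obtain t m n where eq: "35 * t ^ 3 + (2 * m - n) * (m + n) * (m - 2 * n) = 6 * t * (m\<^sup>2 - m * n + n\<^sup>2)"
    and tZ: "t * (m\<^sup>2 - m * n + n\<^sup>2) = - Z"
    using assms by (elim tangent_descent)
  define a b c where "a = 2 * m - n + 2 * t" and "b = - m - n + 2 * t" and "c = 2 * n - m + 2 * t"
  have abc: "a * b * c = - 27 * t ^ 3"
  proof -
    have "a * b * c = 8 * t ^ 3 - 6 * t * (m\<^sup>2 - m * n + n\<^sup>2) + (2 * m - n) * (m + n) * (m - 2 * n)"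
      by (simp add: a_def b_def c_def algebra_simps power2_eq_square power3_eq_cube)
    then show ?thesis using eq by linarith
  qed
  have "3 dvd a"
  proof -
    have "a * b * c = 3 * (- 9 * t ^ 3)" using abc by simp
    then have "3 dvd a * b * c" by (rule dvdI)
    then have "3 dvd a \<or> 3 dvd b \<or> 3 dvd c"
      using prime_dvd_multD[of "3 :: int" "a * b" c] prime_dvd_multD[of "3 :: int" a b] by auto
    then show ?thesis unfolding a_def b_def c_def by presburger
  qed
  then obtain P where P: "a = 3 * P" by (elim dvdE)
  define Q R where "Q = P - m" and "R = P - m + n"
  have Q: "b = 3 * Q" and R: "c = 3 * R" using P by (simp_all add: a_def b_def c_def Q_def R_def)
  have "27 * (P * Q * R) = - 27 * t ^ 3" using abc unfolding P Q R by linarith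
  then have "P * Q * R = - (t ^ 3)" by linarith
  then have 1: "P * Q * R = (- t) ^ 3" by simp
  have "3 * (P + Q + R) = 6 * t" unfolding distrib_left P[symmetric] Q[symmetric] R[symmetric]
    by (simp add: a_def b_def c_def)
  then have "P + Q + R = 2 * t" by presburger
  then have 2: "P + Q + R = - 2 * (- t)" by simp
  have t0: "t \<noteq> 0" using tZ assms(6) by auto
  have tdvd: "- t dvd Z" using tZ by (metis dvd_minus_iff dvd_triv_left minus_dvd_iff)
  have tle: "\<bar>t\<bar> \<le> \<bar>Z\<bar>" using dvd_imp_le_int[OF assms(6) tdvd] by simp
  \<comment> \<open>This makes the decrease strict, as \<open>t\<close> is only known to divide
    \<open>Z\<close>. Otherwise \<open>Z\<close> would be an integer root of
    \<open>Z^3 + 2 Z + 2\<close>, \<open>Z^3 + 2 Z - 2\<close> or \<open>Z^2 - 2\<close>.\<close>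
  have "\<bar>X * Y\<bar> \<ge> 2"
  proof (rule ccontr)
    assume "\<not> \<bar>X * Y\<bar> \<ge> 2"
    moreover have "X * Y \<noteq> 0" using assms(4,5) by simp
    ultimately have "\<bar>X\<bar> * \<bar>Y\<bar> = 1" unfolding abs_mult[symmetric] by linarith
    then have XY: "\<bar>X\<bar> = 1" "\<bar>Y\<bar> = 1" using zmult_eq_1_iff[of "\<bar>X\<bar>" "\<bar>Y\<bar>"] by auto
    have Z3: "Z ^ 3 = Z * Z\<^sup>2" by (simp add: power3_eq_cube power2_eq_square)
    consider "X = 1" "Y = 1" | "X = - 1" "Y = - 1" | "X = - Y" using XY by linarith
    then show False
    proof cases
      case 1
      then have "Z * (Z\<^sup>2 + 2) = - 2" using curve Z3 by (simp add: distrib_left)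
      then have "Z dvd - 2" by (metis dvd_triv_left)
      then have "\<bar>Z\<bar> \<le> 2" using dvd_imp_le_int[of "- 2" Z] by simp
      then have "Z \<in> {-2, -1, 0, 1, 2}" by auto
      then show False using \<open>Z * (Z\<^sup>2 + 2) = - 2\<close> by auto
    next
      case 2
      then have "Z * (Z\<^sup>2 + 2) = 2" using curve Z3 by (simp add: distrib_left)
      then have "Z dvd 2" by (metis dvd_triv_left)
      then have "\<bar>Z\<bar> \<le> 2" using dvd_imp_le_int[of "2" Z] by simp
      then have "Z \<in> {-2, -1, 0, 1, 2}" by auto
      then show False using \<open>Z * (Z\<^sup>2 + 2) = 2\<close> by auto
    next
      case 3
      have "Y\<^sup>2 = 1" using XY(2) by (metis power2_abs power_one)
      have "Z ^ 3 - 2 * Y\<^sup>2 * Z = 0" using curve by (simp add: 3 power2_eq_square)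
      then have "Z * (Z\<^sup>2 - 2) = 0" using Z3 \<open>Y\<^sup>2 = 1\<close> by (simp add: right_diff_distrib)
      then have Z2: "Z\<^sup>2 = 2" using assms(6) by simp
      then have "\<bar>Z\<bar> < 2" using abs_le_square_iff[of 2 Z] by simp
      then have "Z \<in> {-1, 0, 1}" by auto
      then show False using Z2 by auto
    qed
  qed
  then have "2 * \<bar>Z\<bar> \<le> \<bar>X * Y\<bar> * \<bar>Z\<bar>" by (rule mult_right_mono) simp
  then have "\<bar>- t\<bar> < \<bar>X * Y * Z\<bar>" using tle assms(6) unfolding abs_mult[of "X * Y" Z] by linarith
  then show ?thesis using that[OF 1 2] t0 by simp
qed

text \<open>A prime common to all four numbers can be cancelled. Otherwise a prime dividing two of
  \<open>P\<close>, \<open>Q\<close>, \<open>R\<close> would divide \<open>T\<close> and, by the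
  sum, the third; so they are pairwise coprime, hence cubes, and \<open>T = X Y Z\<close>
  descends.\<close>

lemma no_product_sum_cube_int:
  fixes P Q R T :: int
  assumes "P * Q * R = T ^ 3" "P + Q + R = - 2 * T"
  shows "T = 0"
  using assms
proof (induction "nat \<bar>T\<bar>" arbitrary: P Q R T rule: less_induct)
  case less
  show ?case
  proof (rule ccontr)
    assume T: "T \<noteq> 0"
    have common: False if "prime p" "p dvd P" "p dvd Q" "p dvd R" "p dvd T" for p
    proof -
      obtain P' Q' R' T' where d: "P = p * P'" "Q = p * Q'" "R = p * R'" "T = p * T'"
        using \<open>p dvd P\<close> \<open>p dvd Q\<close> \<open>p dvd R\<close> \<open>p dvd T\<close> unfolding dvd_def by blast
      have p: "p \<ge> 2" using that(1) prime_ge_2_int by blast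
      have "p ^ 3 * (P' * Q' * R') = p ^ 3 * T' ^ 3" using less.prems(1)
        by (simp add: d power3_eq_cube mult_ac)
      then have "P' * Q' * R' = T' ^ 3" using p by simp
      moreover have "p * (P' + Q' + R') = p * (- 2 * T')" using less.prems(2)
        by (simp add: d algebra_simps)
      then have "P' + Q' + R' = - 2 * T'" using p by (metis mult_left_cancel not_numeral_le_zero)
      moreover have "nat \<bar>T'\<bar> < nat \<bar>T\<bar>"
      proof -
        have "2 * \<bar>T'\<bar> \<le> p * \<bar>T'\<bar>" using p by (intro mult_right_mono) simp_all
        then show ?thesis using T p by (simp add: d abs_mult)
      qed
      ultimately have "T' = 0" by (intro less.hyps)
      then show False using T d by simp
    qed
    have pT: "p dvd T" if "prime p" "p dvd P * Q * R" for p
      using that less.prems(1) by (metis prime_dvd_power)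
    have R: "R = - 2 * T - P - Q" and Q: "Q = - 2 * T - P - R" and P: "P = - 2 * T - Q - R"
      using less.prems(2) by linarith+
    have PQ: "coprime P Q"
    proof (rule int_coprimeI_prime)
      fix p :: int assume p: "prime p" "p dvd P" "p dvd Q"
      then have T: "p dvd T" using pT by simp
      then have "p dvd R" using p unfolding R by (intro dvd_diff dvd_mult)
      then show False using common p T by blast
    qed
    have PR: "coprime P R"
    proof (rule int_coprimeI_prime)
      fix p :: int assume p: "prime p" "p dvd P" "p dvd R"
      then have T: "p dvd T" using pT by simp
      then have "p dvd Q" using p unfolding Q by (intro dvd_diff dvd_mult)
      then show False using common p T by blast
    qed
    have QR: "coprime Q R"
    proof (rule int_coprimeI_prime)
      fix p :: int assume p: "prime p" "p dvd Q" "p dvd R"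
      then have T: "p dvd T" using pT by simp
      then have "p dvd P" using p unfolding P by (intro dvd_diff dvd_mult)
      then show False using common p T by blast
    qed
    obtain X where X: "P = X ^ 3"
      by (rule int_coprime_mult_cube[of P "Q * R" T]) (use PQ PR less.prems(1) in \<open>simp_all add: mult_ac\<close>)
    obtain Y where Y: "Q = Y ^ 3"
      by (rule int_coprime_mult_cube[of Q "P * R" T])
        (use PQ QR less.prems(1) in \<open>simp_all add: mult_ac coprime_commute\<close>)
    obtain Z where Z: "R = Z ^ 3"
      by (rule int_coprime_mult_cube[of R "P * Q" T])
        (use PR QR less.prems(1) in \<open>simp_all add: mult_ac coprime_commute\<close>)
    have "(X * Y * Z) ^ 3 = T ^ 3" using less.prems(1) by (simp add: X Y Z power_mult_distrib)
    then have TXYZ: "T = X * Y * Z" by (simp only: int_cube_eq_iff)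
    have nz: "X \<noteq> 0" "Y \<noteq> 0" "Z \<noteq> 0" using T TXYZ by auto
    have cop: "coprime X Y" "coprime Y X" "coprime X Z" "coprime Z X" "coprime Y Z" "coprime Z Y"
      using PQ PR QR by (simp_all add: X Y Z coprime_commute)
    have curve: "X ^ 3 + Y ^ 3 + Z ^ 3 + 2 * X * Y * Z = 0"
      "Y ^ 3 + Z ^ 3 + X ^ 3 + 2 * Y * Z * X = 0" "Z ^ 3 + X ^ 3 + Y ^ 3 + 2 * Z * X * Y = 0"
      using less.prems(2) by (simp_all add: X Y Z TXYZ mult_ac)
    have "\<exists>P Q R T'. P * Q * R = T' ^ 3 \<and> P + Q + R = - 2 * T' \<and> T' \<noteq> 0 \<and> \<bar>T'\<bar> < \<bar>T\<bar>"
      using cubic_mod_7[OF curve(1)]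
    proof (elim disjE)
      assume "7 dvd 3 * X + 3 * Y - 2 * Z"
      then show ?thesis
        by (rule descent_step[OF curve(1) cop(3,5) nz(1,2,3)]) (auto simp: TXYZ mult_ac)
    next
      assume "7 dvd 3 * Y + 3 * Z - 2 * X"
      then show ?thesis
        by (rule descent_step[OF curve(2) cop(2,4) nz(2,3,1)]) (auto simp: TXYZ mult_ac)
    next
      assume "7 dvd 3 * Z + 3 * X - 2 * Y"
      then show ?thesis
        by (rule descent_step[OF curve(3) cop(6,1) nz(3,1,2)]) (auto simp: TXYZ mult_ac)
    qed
    then obtain P' Q' R' T' where new: "P' * Q' * R' = T' ^ 3" "P' + Q' + R' = - 2 * T'"
      "T' \<noteq> 0" "\<bar>T'\<bar> < \<bar>T\<bar>" by blast
    have "nat \<bar>T'\<bar> < nat \<bar>T\<bar>" using new(4) by simp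
    from less.hyps[OF this new(1,2)] new(3) show False by simp
  qed
qed

lemma no_product_sum_cube_rat:
  fixes P Q R T :: rat
  assumes "P * Q * R = T ^ 3" "P + Q + R = - 2 * T"
  shows "T = 0"
proof -
  have den: "\<exists>d. d \<noteq> 0 \<and> (\<exists>a. of_int d * x = (of_int a :: rat))" for x :: rat
  proof (cases x)
    case (Fract a b)
    then show ?thesis by (intro exI[of _ b]) (auto simp: Fract_of_int_quotient)
  qed
  obtain p q r t a b c e where d: "p \<noteq> 0" "q \<noteq> 0" "r \<noteq> 0" "t \<noteq> 0"
    "of_int p * P = of_int a" "of_int q * Q = of_int b" "of_int r * R = of_int c" "of_int t * T = of_int e"
    using den[of P] den[of Q] den[of R] den[of T] by blast
  define D where "D = p * q * r * t"
  define P' Q' R' T' where "P' = q * r * t * a" and "Q' = p * r * t * b"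
    and "R' = p * q * t * c" and "T' = p * q * r * e"
  have eq: "of_int P' = of_int D * P" "of_int Q' = of_int D * Q"
    "of_int R' = of_int D * R" "of_int T' = of_int D * T"
    by (simp_all add: P'_def Q'_def R'_def T'_def D_def d(5-8)[symmetric] mult_ac)
  have "(of_int (P' * Q' * R') :: rat) = of_int D ^ 3 * (P * Q * R)"
    by (simp add: eq power3_eq_cube mult_ac)
  also have "\<dots> = of_int (T' ^ 3)" by (simp add: assms(1) eq power_mult_distrib)
  finally have 1: "P' * Q' * R' = T' ^ 3" by (simp only: of_int_eq_iff)
  have "(of_int (P' + Q' + R') :: rat) = of_int D * (P + Q + R)"
    by (simp add: eq algebra_simps)
  also have "\<dots> = of_int (- 2 * T')" by (simp add: assms(2) eq)
  finally have "P' + Q' + R' = - 2 * T'" by (simp only: of_int_eq_iff)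
  with 1 have "T' = 0" by (rule no_product_sum_cube_int)
  then have "of_int D * T = 0" using eq(4) by simp
  then show ?thesis using d(1-4) by (simp add: D_def)
qed

subsection \<open>Descent by a 2-isogeny\<close>

lemma int_coprime_mult_power:
  fixes a b c :: int
  assumes "coprime a b" "a > 0" "b > 0" "a * b = c ^ n" "n > 0"
  obtains t where "a = t ^ n" "t > 0"
proof -
  have "nat \<bar>a\<bar> * nat \<bar>b\<bar> = nat \<bar>c\<bar> ^ n"
    using arg_cong[OF assms(4), of "\<lambda>x. nat \<bar>x\<bar>"]
    by (simp add: abs_mult power_abs nat_mult_distrib nat_power_eq)
  moreover have "coprime (nat \<bar>a\<bar>) (nat \<bar>b\<bar>)" using assms(1) by simp
  ultimately have "is_nth_power n (nat \<bar>a\<bar>)"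
    using is_nth_power_mult_coprime_nat_iff[of "nat \<bar>a\<bar>" "nat \<bar>b\<bar>" n]
      is_nth_power_nth_power[of n "nat \<bar>c\<bar>"] by simp
  then obtain k where k: "nat \<bar>a\<bar> = k ^ n" by (elim is_nth_powerE)
  then have a: "a = int k ^ n" using assms(2) by (metis abs_of_pos nat_0_le of_nat_power order_less_imp_le)
  then have "int k > 0" using assms(2,5) by (cases "k = 0") (simp_all add: power_0_left)
  with a show ?thesis using that by blast
qed

lemma coprime_mult_fourth_power:
  fixes r s m :: int
  assumes "coprime r s" "r > 0" "s > 0" "r * s = m ^ 4" "m > 0"
  obtains a b where "a > 0" "b > 0" "coprime a b" "r = a ^ 4" "s = b ^ 4" "m = a * b"
proof -
  obtain a where a: "r = a ^ 4" "a > 0"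
    by (rule int_coprime_mult_power[OF assms(1-4)]) simp_all
  have "coprime s r" "s * r = m ^ 4" using assms(1,4) by (simp_all add: coprime_commute mult.commute)
  then obtain b where b: "s = b ^ 4" "b > 0"
    using int_coprime_mult_power[OF _ assms(3,2)] by (metis zero_less_numeral)
  have "(a * b) ^ 4 = m ^ 4" using assms(4) by (simp add: a b power_mult_distrib)
  then have "a * b = m" by (rule power_eq_imp_eq_base) (use a b assms(5) in simp_all)
  moreover have "coprime a b" using assms(1) by (simp add: a b)
  ultimately show ?thesis using that a b by metis
qed

lemma pos_factors:
  fixes r s :: int
  assumes "r * s > 0" "r + s > 0"
  shows "r > 0" "s > 0"
  using assms by (auto simp: zero_less_mult_iff)

text \<open>A prime dividing \<open>r\<close> and \<open>s\<close> divides \<open>m\<close>, even if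
  it is 7, since then 49 divides \<open>7 m^4\<close>. So \<open>np\<close> gives coprimality, and
  only the place of the factor 7 stays open.\<close>

lemma seven_fourth_power_split:
  fixes r s m :: int
  assumes rs: "r * s = 7 * m ^ 4" and "r + s > 0" "m > 0"
    and np: "\<And>p. prime p \<Longrightarrow> p dvd r \<Longrightarrow> p dvd s \<Longrightarrow> p dvd m \<Longrightarrow> False"
  obtains a b where "a > 0" "b > 0" "coprime a b" "m = a * b"
    "r = 7 * a ^ 4 \<and> s = b ^ 4 \<or> r = a ^ 4 \<and> s = 7 * b ^ 4"
proof -
  have "r * s > 0" using rs assms(3) by simp
  note pos = pos_factors[OF this assms(2)]
  have cop: "coprime r s"
  proof (rule int_coprimeI_prime)
    fix p :: int assume p: "prime p" "p dvd r" "p dvd s"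
    have "p dvd m ^ 4"
    proof (cases "p dvd 7")
      case True
      then have p7: "p = 7" using primes_dvd_imp_eq[OF p(1), of 7] by simp
      from p obtain r' s' where "r = 7 * r'" "s = 7 * s'" unfolding p7 by (elim dvdE)
      then have "7 * (7 * (r' * s')) = 7 * m ^ 4" using rs by simp
      then have "m ^ 4 = 7 * (r' * s')" by linarith
      then show ?thesis unfolding p7 by (rule dvdI)
    next
      case False
      have "p dvd 7 * m ^ 4" unfolding rs[symmetric] using p(2) by (rule dvd_mult2)
      then show ?thesis using False p(1) prime_dvd_multD by blast
    qed
    then have "p dvd m" using p(1) prime_dvd_power by blast
    then show False using np p by blast
  qed
  have "7 dvd r * s" unfolding rs by simp
  then consider "7 dvd r" | "7 dvd s" using prime_dvd_multD[of "7 :: int" r s] by auto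
  then show ?thesis
  proof cases
    case 1
    then obtain r' where r': "r = 7 * r'" by (elim dvdE)
    have "coprime r' s" "r' > 0" "r' * s = m ^ 4" using cop pos rs by (simp_all add: r')
    then obtain a b where "a > 0" "b > 0" "coprime a b" "r' = a ^ 4" "s = b ^ 4" "m = a * b"
      using coprime_mult_fourth_power[OF _ _ pos(2) _ assms(3)] by metis
    then show ?thesis by (intro that[of a b]) (simp_all add: r')
  next
    case 2
    then obtain s' where s': "s = 7 * s'" by (elim dvdE)
    have "coprime r s'" "s' > 0" "r * s' = m ^ 4" using cop pos rs by (simp_all add: s')
    then obtain a b where "a > 0" "b > 0" "coprime a b" "r = a ^ 4" "s' = b ^ 4" "m = a * b"
      using coprime_mult_fourth_power[OF _ pos(1) _ _ assms(3)] by metis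
    then show ?thesis by (intro that[of a b]) (simp_all add: s')
  qed
qed

lemma odd_square_int:
  fixes x :: int
  assumes "odd x"
  obtains k where "x\<^sup>2 = 8 * k + 1"
proof -
  obtain j where j: "x = 2 * j + 1" using assms by (elim oddE)
  have "even (j * (j + 1))" by simp
  then obtain k where k: "j * (j + 1) = 2 * k" by (elim evenE)
  have "x\<^sup>2 = 4 * (j * (j + 1)) + 1" by (simp add: j power2_eq_square algebra_simps)
  then have "x\<^sup>2 = 8 * k + 1" unfolding k by simp
  then show ?thesis using that by blast
qed

lemma odd_prime_dvd_power2_mult:
  fixes p x :: int
  assumes "prime p" "p dvd 2 ^ k * x" "p \<noteq> 2"
  shows "p dvd x"
proof -
  have "\<not> p dvd 2" using assms(1,3) primes_dvd_imp_eq[of p 2] by auto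
  then have "\<not> p dvd 2 ^ k" using assms(1) prime_dvd_power by blast
  then show ?thesis using assms(1,2) prime_dvd_multD by blast
qed

lemma fourth_power_eq: "(x :: int) ^ 4 = (x\<^sup>2)\<^sup>2"
  by (simp add: power_mult[symmetric])

text \<open>Completing the square in \<open>n^2\<close> gives \<open>r * s = 7 m^4\<close>, as 4 * 8
  * 4 - 11^2 = 7. The split \<open>m = a b\<close> yields
  \<open>16 n^2 = b^4 + 22 a^2 b^2 - 7 a^4\<close>, and completing that square gives
  \<open>R * S = 2 a^4\<close>, as 11^2 + 7 = 2^7. The split \<open>a = d c\<close> turns
  \<open>R + S\<close> into the original quartic for \<open>(d, c)\<close>, with \<open>b\<close> in
  the place of \<open>q\<close>.\<close>

lemma quartic_odd_odd:
  fixes m n q :: int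
  assumes "8 * m ^ 4 - 11 * m\<^sup>2 * n\<^sup>2 + 4 * n ^ 4 = q\<^sup>2"
    "odd m" "odd n" "coprime m n" "m > 0" "n > 0"
  shows "m = 1 \<and> n = 1"
  using assms
proof (induction "nat m" arbitrary: m n q rule: less_induct)
  case less
  define Q where "Q = \<bar>q\<bar>"
  have Q2: "Q\<^sup>2 = 8 * m ^ 4 - 11 * m\<^sup>2 * n\<^sup>2 + 4 * n ^ 4" using less.prems(1) by (simp add: Q_def)
  have "odd (8 * m ^ 4 - 11 * m\<^sup>2 * n\<^sup>2 + 4 * n ^ 4)" using less.prems(2,3) by simp
  then have "Q \<noteq> 0" using Q2 by (metis even_zero zero_power2)
  then have Q0: "Q > 0" by (simp add: Q_def)
  define r s where "r = 4 * Q - (8 * n\<^sup>2 - 11 * m\<^sup>2)" and "s = 4 * Q + (8 * n\<^sup>2 - 11 * m\<^sup>2)"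
  have "r * s = 16 * Q\<^sup>2 - (8 * n\<^sup>2 - 11 * m\<^sup>2)\<^sup>2"
    by (simp add: r_def s_def algebra_simps power2_eq_square)
  also have "\<dots> = 7 * m ^ 4"
    unfolding Q2 fourth_power_eq by (simp add: power2_eq_square algebra_simps)
  finally have rs: "r * s = 7 * m ^ 4" .
  have odd_r: "odd r" using less.prems by (simp add: r_def)
  have "r + s > 0" using Q0 by (simp add: r_def s_def)
  have np: False if p: "prime p" "p dvd r" "p dvd s" "p dvd m" for p
  proof -
    have "p \<noteq> 2" using p(2) odd_r by auto
    have "2 ^ 4 * n\<^sup>2 = s - r + 22 * m * m" by (simp add: r_def s_def power2_eq_square)
    moreover have "p dvd s - r + 22 * m * m" using p by (intro dvd_add dvd_diff dvd_mult)
    ultimately have "p dvd n\<^sup>2" using odd_prime_dvd_power2_mult p(1) \<open>p \<noteq> 2\<close> by metis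
    then have "p dvd n" using p(1) prime_dvd_power by blast
    then show False using p less.prems(4) by (meson coprime_common_divisor not_prime_unit)
  qed
  obtain a b where ab: "a > 0" "b > 0" "coprime a b" "m = a * b"
    and cases: "r = 7 * a ^ 4 \<and> s = b ^ 4 \<or> r = a ^ 4 \<and> s = 7 * b ^ 4"
    by (rule seven_fourth_power_split[OF rs \<open>r + s > 0\<close> less.prems(5) np])
  have n16: "16 * n\<^sup>2 = s - r + 22 * a\<^sup>2 * b\<^sup>2"
    by (simp add: r_def s_def ab(4) power_mult_distrib)
  have oab: "odd a" "odd b" using less.prems(2) ab(4) by auto
  obtain i where i: "a\<^sup>2 = 8 * i + 1" using oab(1) by (rule odd_square_int)
  obtain j where j: "b\<^sup>2 = 8 * j + 1" using oab(2) by (rule odd_square_int)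
  from cases have r: "r = 7 * a ^ 4" and s: "s = b ^ 4"
  proof -
    have "\<not> (r = a ^ 4 \<and> s = 7 * b ^ 4)"
    proof
      assume "r = a ^ 4 \<and> s = 7 * b ^ 4"
      \<comment> \<open>Odd squares are 1 modulo 8, so \<open>7 b^4 - a^4 + 22 a^2 b^2\<close> is 12
        modulo 16.\<close>
      have no_sol: "16 * x \<noteq> 4 * (4 * w + 3)" for x w :: int by presburger
      from \<open>r = a ^ 4 \<and> s = 7 * b ^ 4\<close> have rs: "r = a ^ 4" "s = 7 * b ^ 4" by auto
      have "16 * n\<^sup>2 = 7 * (8 * j + 1)\<^sup>2 - (8 * i + 1)\<^sup>2 + 22 * (8 * i + 1) * (8 * j + 1)"
        using n16 unfolding rs fourth_power_eq i j .
      also have "\<dots> = 4 * (4 * (28 * j\<^sup>2 + 7 * j - 4 * i\<^sup>2 - i + 88 * i * j + 11 * i + 11 * j + 1) + 3)"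
        by algebra
      finally show False using no_sol by blast
    qed
    then show "r = 7 * a ^ 4" "s = b ^ 4" using cases by auto
  qed
  obtain h where h: "n = 2 * h + 1" using less.prems(3) by (elim oddE)
  \<comment> \<open>These are \<open>(b^2 + 11 a^2 - 4 n) / 8\<close> and
    \<open>(b^2 + 11 a^2 + 4 n) / 8\<close>, integral because \<open>a\<close>, \<open>b\<close>,
    \<open>n\<close> are odd.\<close>
  define R S where "R = j + 11 * i + 1 - h" and "S = j + 11 * i + 2 + h"
  have R8: "8 * R = b\<^sup>2 + 11 * a\<^sup>2 - 4 * n" and S8: "8 * S = b\<^sup>2 + 11 * a\<^sup>2 + 4 * n"
    by (simp_all add: R_def S_def i j h)
  have "64 * (R * S) = (8 * R) * (8 * S)" by simp
  also have "\<dots> = (b\<^sup>2 + 11 * a\<^sup>2)\<^sup>2 - 16 * n\<^sup>2"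
    unfolding R8 S8 by (simp add: algebra_simps power2_eq_square)
  also have "\<dots> = 128 * a ^ 4"
    unfolding n16 r s fourth_power_eq by (simp add: algebra_simps power2_eq_square)
  finally have RS: "R * S = 2 * a ^ 4" by simp
  have sum': "4 * R + 4 * S = b\<^sup>2 + 11 * a\<^sup>2" using R8 S8 by linarith
  then have sum: "4 * (R + S) = b\<^sup>2 + 11 * a\<^sup>2" by simp
  have "b\<^sup>2 > 0" "a\<^sup>2 > 0" using ab by simp_all
  then have "R + S > 0" using sum' by linarith
  moreover have "R * S > 0" using RS ab(1) by simp
  ultimately have pos: "R > 0" "S > 0" using pos_factors by blast+
  have cop: "coprime R S"
  proof (rule int_coprimeI_prime)
    fix p :: int assume p: "prime p" "p dvd R" "p dvd S"
    have p2: "p \<noteq> 2"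
    proof
      assume "p = 2"
      then obtain R' S' where "R = 2 * R'" "S = 2 * S'" using p by (metis dvdE)
      then have "2 * (2 * (R' * S')) = 2 * a ^ 4" using RS by simp
      then have "a ^ 4 = 2 * (R' * S')" by linarith
      then have "even (a ^ 4)" by simp
      then show False using oab by simp
    qed
    have "p dvd 2 ^ 1 * a ^ 4" using RS p(2) by (metis dvd_mult2 power_one_right)
    then have "p dvd a ^ 4" using odd_prime_dvd_power2_mult p(1) p2 by blast
    then have pa: "p dvd a" using p(1) prime_dvd_power by blast
    have "b\<^sup>2 = 4 * (R + S) - 11 * a * a" using sum by (simp add: power2_eq_square)
    moreover have "p dvd 4 * (R + S) - 11 * a * a" using p pa by (intro dvd_diff dvd_mult dvd_add)
    ultimately have "p dvd b\<^sup>2" by simp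
    then have "p dvd b" using p(1) prime_dvd_power by blast
    then show False using p pa ab(3) by (meson coprime_common_divisor not_prime_unit)
  qed
  have "\<exists>c d. c > 0 \<and> d > 0 \<and> coprime d c \<and> a = d * c \<and> R + S = 2 * d ^ 4 + c ^ 4"
  proof -
    have "even (R * S)" using RS by simp
    then consider "even R" | "even S" by auto
    then show ?thesis
    proof cases
      case 1
      then obtain R' where R': "R = 2 * R'" by (elim evenE)
      have "coprime R' S" "R' > 0" "R' * S = a ^ 4" using cop pos RS by (simp_all add: R')
      then obtain d c where "d > 0" "c > 0" "coprime d c" "R' = d ^ 4" "S = c ^ 4" "a = d * c"
        using coprime_mult_fourth_power[OF _ _ pos(2) _ ab(1)] by metis
      then show ?thesis by (intro exI[of _ c] exI[of _ d]) (simp add: R')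
    next
      case 2
      then obtain S' where S': "S = 2 * S'" by (elim evenE)
      have "coprime S' R" "S' > 0" "S' * R = a ^ 4"
        using cop pos RS by (simp_all add: S' coprime_commute mult.commute)
      then obtain d c where "d > 0" "c > 0" "coprime d c" "S' = d ^ 4" "R = c ^ 4" "a = d * c"
        using coprime_mult_fourth_power[OF _ _ pos(1) _ ab(1)] by metis
      then show ?thesis by (intro exI[of _ c] exI[of _ d]) (simp add: S')
    qed
  qed
  then obtain c d where cd: "c > 0" "d > 0" "coprime d c" "a = d * c" "R + S = 2 * d ^ 4 + c ^ 4"
    by blast
  have eq: "8 * d ^ 4 - 11 * d\<^sup>2 * c\<^sup>2 + 4 * c ^ 4 = b\<^sup>2"
    using sum unfolding cd(4,5) by (simp add: power_mult_distrib)
  have "a = 1 \<and> b = 1"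
  proof (cases "d < m")
    case True
    then have "nat d < nat m" using cd by simp
    from less.hyps[OF this eq] have "d = 1 \<and> c = 1" using oab cd by auto
    then show ?thesis using eq ab(2) cd(4) by (simp add: power2_eq_1_iff)
  next
    case False
    \<comment> \<open>The descent stalls here, which forces \<open>c = b = 1\<close>; the quartic
      then has \<open>d = 1\<close> as its only positive integer root.\<close>
    have m: "m = d * (c * b)" using ab(4) cd(4) by simp
    then have "d * (c * b) \<le> d * 1" using False by simp
    then have "c * b \<le> 1" using cd(2) by simp
    moreover have "c * b > 0" using cd(1) ab(2) by simp
    ultimately have "c * b = 1" by linarith
    then have cb: "c = 1" "b = 1" using zmult_eq_1_iff[of c b] cd(1) ab(2) by auto
    have "(d\<^sup>2 - 1) * (8 * d\<^sup>2 - 3) = 0"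
      using eq unfolding cb fourth_power_eq by (simp add: algebra_simps power2_eq_square)
    moreover have "8 * d\<^sup>2 - 3 \<noteq> 0" by presburger
    ultimately have "d\<^sup>2 = 1" by simp
    then show ?thesis using cb cd by (simp add: power2_eq_1_iff)
  qed
  then have "m = 1" "16 * n\<^sup>2 = 16" using ab(4) n16 r s by simp_all
  then show ?case using less.prems(6) by (simp add: power2_eq_1_iff)
qed

text \<open>With \<open>e = 2 f\<close>, the two completed squares give \<open>r * s = 7 f^4\<close>
  and \<open>R * S = 32 a^4\<close>. The odd one of \<open>R\<close> and \<open>S\<close> is
  \<open>c^4\<close>, the other \<open>32 d^4\<close>, and their sum returns the quartic for
  \<open>(c, d)\<close>. Since \<open>d \<le> f < e\<close>, the descent is always strict.\<close>

lemma quartic_odd_even: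
  fixes n e q :: int
  assumes "n ^ 4 - 11 * n\<^sup>2 * e\<^sup>2 + 32 * e ^ 4 = q\<^sup>2"
    "odd n" "even e" "coprime n e" "n > 0" "e > 0"
  shows False
  using assms
proof (induction "nat e" arbitrary: n e q rule: less_induct)
  case less
  obtain f where e: "e = 2 * f" using less.prems(3) by (elim evenE)
  have f0: "f > 0" using less.prems(6) e by simp
  define Q where "Q = \<bar>q\<bar>"
  have Q2: "Q\<^sup>2 = n ^ 4 - 44 * n\<^sup>2 * f\<^sup>2 + 512 * f ^ 4"
    using less.prems(1) by (simp add: Q_def e power_mult_distrib)
  have "odd (n ^ 4 - 44 * n\<^sup>2 * f\<^sup>2 + 512 * f ^ 4)" using less.prems(2) by simp
  then have oQ: "odd Q" unfolding Q2[symmetric] by simp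
  then have "Q \<noteq> 0" by auto
  then have Q0: "Q > 0" by (simp add: Q_def)
  have "even (Q - n\<^sup>2)" using oQ less.prems(2) by simp
  then obtain w where w: "Q - n\<^sup>2 = 2 * w" by (elim evenE)
  define r s where "r = w + 11 * f\<^sup>2" and "s = w + n\<^sup>2 - 11 * f\<^sup>2"
  have r2: "2 * r = Q - (n\<^sup>2 - 22 * f\<^sup>2)" and s2: "2 * s = Q + (n\<^sup>2 - 22 * f\<^sup>2)"
    using w by (simp_all add: r_def s_def)
  have "4 * (r * s) = (2 * r) * (2 * s)" by simp
  also have "\<dots> = Q\<^sup>2 - (n\<^sup>2 - 22 * f\<^sup>2)\<^sup>2"
    unfolding r2 s2 by (simp add: algebra_simps power2_eq_square)
  also have "\<dots> = 28 * f ^ 4"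
    unfolding Q2 fourth_power_eq by (simp add: power2_eq_square algebra_simps)
  finally have rs: "r * s = 7 * f ^ 4" by simp
  have rsQ: "r + s = Q" using w by (simp add: r_def s_def)
  then have "r + s > 0" using Q0 by simp
  have cop: "coprime n f" using less.prems(4) by (simp add: e)
  have np: False if p: "prime p" "p dvd r" "p dvd s" "p dvd f" for p
  proof -
    have "n\<^sup>2 = s - r + 22 * f * f" by (simp add: r_def s_def power2_eq_square)
    moreover have "p dvd s - r + 22 * f * f" using p by (intro dvd_add dvd_diff dvd_mult)
    ultimately have "p dvd n\<^sup>2" by metis
    then have "p dvd n" using p(1) prime_dvd_power by blast
    then show False using p cop by (meson coprime_common_divisor not_prime_unit)
  qed
  obtain a b where ab: "a > 0" "b > 0" "coprime a b" "f = a * b"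
    and cases: "r = 7 * a ^ 4 \<and> s = b ^ 4 \<or> r = a ^ 4 \<and> s = 7 * b ^ 4"
    by (rule seven_fourth_power_split[OF rs \<open>r + s > 0\<close> f0 np])
  have n2: "n\<^sup>2 = s - r + 22 * a\<^sup>2 * b\<^sup>2"
    by (simp add: r_def s_def ab(4) power_mult_distrib)
  have "odd (r + s)" using rsQ oQ by simp
  then have parity: "odd a \<and> even b \<or> even a \<and> odd b" using cases by auto
  obtain k where k: "n\<^sup>2 = 8 * k + 1" using less.prems(2) by (rule odd_square_int)
  have r: "r = 7 * a ^ 4" and s: "s = b ^ 4"
  proof -
    have "\<not> (r = a ^ 4 \<and> s = 7 * b ^ 4)"
    proof
      assume "r = a ^ 4 \<and> s = 7 * b ^ 4"
      then have rs: "r = a ^ 4" "s = 7 * b ^ 4" by auto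
      have eq: "8 * k + 1 = 7 * (b\<^sup>2)\<^sup>2 - (a\<^sup>2)\<^sup>2 + 22 * a\<^sup>2 * b\<^sup>2"
        using n2 unfolding k rs fourth_power_eq .
      \<comment> \<open>\<open>n^2\<close> is 1 modulo 8, but for \<open>a\<close>, \<open>b\<close>
        of opposite parity the right-hand side is 3 modulo 4.\<close>
      have no_sol: "8 * x + 1 \<noteq> 4 * w - 1" "8 * x + 1 \<noteq> 4 * w + 7" for x w :: int by presburger+
      show False using parity
      proof (elim disjE conjE)
        assume "odd a" "even b"
        then obtain i j where ij: "a\<^sup>2 = 8 * i + 1" "b = 2 * j" by (metis evenE odd_square_int)
        have "8 * k + 1 = 7 * (4 * j\<^sup>2)\<^sup>2 - (8 * i + 1)\<^sup>2 + 22 * (8 * i + 1) * (4 * j\<^sup>2)"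
          using eq by (simp add: ij power_mult_distrib)
        also have "\<dots> = 4 * (28 * j ^ 4 - 16 * i\<^sup>2 - 4 * i + 22 * (8 * i + 1) * j\<^sup>2) - 1"
          by algebra
        finally show False using no_sol(1) by blast
      next
        assume "even a" "odd b"
        then obtain i j where ij: "b\<^sup>2 = 8 * i + 1" "a = 2 * j" by (metis evenE odd_square_int)
        have "8 * k + 1 = 7 * (8 * i + 1)\<^sup>2 - (4 * j\<^sup>2)\<^sup>2 + 22 * (4 * j\<^sup>2) * (8 * i + 1)"
          using eq by (simp add: ij power_mult_distrib)
        also have "\<dots> = 4 * (112 * i\<^sup>2 + 28 * i - 4 * j ^ 4 + 22 * (8 * i + 1) * j\<^sup>2) + 7"
          by algebra
        finally show False using no_sol(2) by blast
      qed
    qed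
    then show "r = 7 * a ^ 4" "s = b ^ 4" using cases by auto
  qed
  have "even (b\<^sup>2 + 11 * a\<^sup>2 - n)" using parity less.prems(2) by auto
  then obtain R where R: "b\<^sup>2 + 11 * a\<^sup>2 - n = 2 * R" by (elim evenE)
  define S where "S = R + n"
  have S: "b\<^sup>2 + 11 * a\<^sup>2 + n = 2 * S" using R by (simp add: S_def)
  have "4 * (R * S) = (2 * R) * (2 * S)" by simp
  also have "\<dots> = (b\<^sup>2 + 11 * a\<^sup>2)\<^sup>2 - n\<^sup>2"
    unfolding R[symmetric] S[symmetric] by (simp add: algebra_simps power2_eq_square)
  also have "\<dots> = 128 * a ^ 4"
    unfolding n2 r s fourth_power_eq by (simp add: algebra_simps power2_eq_square)
  finally have RS: "R * S = 32 * a ^ 4" by simp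
  have sum: "R + S = b\<^sup>2 + 11 * a\<^sup>2" using R by (simp add: S_def)
  have "b\<^sup>2 > 0" "a\<^sup>2 > 0" using ab by simp_all
  then have "R + S > 0" using sum by linarith
  moreover have "R * S > 0" using RS ab(1) by simp
  ultimately have pos: "R > 0" "S > 0" using pos_factors by blast+
  have odd_sum: "odd (R + S)" unfolding sum using parity by auto
  have cop: "coprime R S"
  proof (rule int_coprimeI_prime)
    fix p :: int assume p: "prime p" "p dvd R" "p dvd S"
    have p2: "p \<noteq> 2" using p odd_sum by auto
    have "p dvd 2 ^ 5 * a ^ 4" using RS p(2) dvd_mult2[of p R S] by simp
    then have "p dvd a ^ 4" using odd_prime_dvd_power2_mult p(1) p2 by blast
    then have pa: "p dvd a" using p(1) prime_dvd_power by blast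
    have "b\<^sup>2 = (R + S) - 11 * a * a" using sum by (simp add: power2_eq_square)
    moreover have "p dvd (R + S) - 11 * a * a" using p pa by (intro dvd_diff dvd_mult dvd_add)
    ultimately have "p dvd b\<^sup>2" by simp
    then have "p dvd b" using p(1) prime_dvd_power by blast
    then show False using p pa ab(3) by (meson coprime_common_divisor not_prime_unit)
  qed
  have split: "\<exists>c d. c > 0 \<and> d > 0 \<and> coprime c d \<and> a = c * d \<and> U + V = c ^ 4 + 32 * d ^ 4 \<and> odd c"
    if UV: "coprime U V" "U * V = 32 * a ^ 4" "U > 0" "V > 0" "odd U" for U V
  proof -
    have "coprime U (2 ^ 5)" unfolding coprime_power_right_iff using UV(5) by simp
    moreover have "2 ^ 5 dvd U * V" unfolding UV(2) by simp
    ultimately have "2 ^ 5 dvd V" by (simp only: coprime_commute coprime_dvd_mult_right_iff)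
    then obtain V' where V': "V = 32 * V'" by (auto elim: dvdE)
    have "coprime U V'" "V' > 0" "U * V' = a ^ 4" using UV by (simp_all add: V')
    then obtain c d where "c > 0" "d > 0" "coprime c d" "U = c ^ 4" "V' = d ^ 4" "a = c * d"
      using coprime_mult_fourth_power[OF _ UV(3) _ _ ab(1)] by metis
    then show ?thesis using UV(5) by (intro exI[of _ c] exI[of _ d]) (simp add: V')
  qed
  have "\<exists>c d. c > 0 \<and> d > 0 \<and> coprime c d \<and> a = c * d \<and> R + S = c ^ 4 + 32 * d ^ 4 \<and> odd c"
  proof (cases "odd R")
    case True
    then show ?thesis using split[OF cop RS pos] by blast
  next
    case False
    then have "odd S" using odd_sum by simp
    moreover have "coprime S R" "S * R = 32 * a ^ 4" using cop RS by (simp_all add: coprime_commute mult.commute)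
    ultimately show ?thesis using split[OF _ _ pos(2,1)] by (simp add: add.commute)
  qed
  then obtain c d where cd: "c > 0" "d > 0" "coprime c d" "a = c * d" "R + S = c ^ 4 + 32 * d ^ 4" "odd c"
    by blast
  have eq: "c ^ 4 - 11 * c\<^sup>2 * d\<^sup>2 + 32 * d ^ 4 = b\<^sup>2"
    using sum unfolding cd(4,5) by (simp add: power_mult_distrib)
  have "even d"
  proof (rule ccontr)
    assume d: "odd d"
    then have "even b" using parity cd(4,6) by auto
    then obtain b' where b': "b = 2 * b'" by (elim evenE)
    obtain i where i: "c\<^sup>2 = 8 * i + 1" using cd(6) by (rule odd_square_int)
    obtain j where j: "d\<^sup>2 = 8 * j + 1" using d by (rule odd_square_int)
    have no_sol: "4 * x \<noteq> 4 * w + 2" for x w :: int by presburger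
    have "4 * b'\<^sup>2 = (2 * b')\<^sup>2" by (simp add: power_mult_distrib)
    also have "\<dots> = (8 * i + 1)\<^sup>2 - 11 * (8 * i + 1) * (8 * j + 1) + 32 * (8 * j + 1)\<^sup>2"
      using eq[symmetric] unfolding fourth_power_eq i j b' .
    also have "\<dots> = 4 * (16 * i\<^sup>2 + 4 * i - 176 * i * j - 22 * i - 22 * j + 8 * (8 * j + 1)\<^sup>2 - 3) + 2"
      by algebra
    finally show False using no_sol by blast
  qed
  have "d \<le> d * c" "a \<le> a * b" using cd(1,2) ab(1,2) by simp_all
  then have "d \<le> f" using ab(4) cd(4) by (simp add: mult.commute)
  then have "nat d < nat e" using e f0 cd(2) by simp
  from less.hyps[OF this eq cd(6) \<open>even d\<close> cd(3,1,2)] show False .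
qed

text \<open>For \<open>n = 2 k\<close> with \<open>k\<close> odd, division by 4 gives the quartic of
  \<open>quartic_odd_odd\<close> in \<open>(e, k)\<close>, whose solution (1, 1) is the one found
  here. Odd \<open>n\<close> with even \<open>e\<close> is excluded by
  \<open>quartic_odd_even\<close>; the other parities fail modulo 4 or 8.\<close>

lemma quartic_coprime:
  fixes n e q :: int
  assumes eq: "n ^ 4 - 11 * n\<^sup>2 * e\<^sup>2 + 32 * e ^ 4 = q\<^sup>2"
    and cop: "coprime n e" and "n > 0" "e > 0"
  shows "n = 2 \<and> e = 1"
proof -
  have eq2: "q\<^sup>2 = (n\<^sup>2)\<^sup>2 - 11 * n\<^sup>2 * e\<^sup>2 + 32 * (e\<^sup>2)\<^sup>2" using eq[symmetric] unfolding fourth_power_eq .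
  have sq8: "False" if "x\<^sup>2 = 8 * w + 7" for x w :: int
  proof -
    have "odd (x\<^sup>2)" unfolding that by simp
    then have "odd x" by simp
    then obtain k where "x\<^sup>2 = 8 * k + 1" by (rule odd_square_int)
    then show False using that by presburger
  qed
  have sq4: "False" if "x\<^sup>2 = 4 * w + 2" for x w :: int
  proof -
    have "even (x\<^sup>2)" unfolding that by simp
    then have "even x" by simp
    then obtain k where "x = 2 * k" by (elim evenE)
    then have "4 * k\<^sup>2 = 4 * w + 2" using that by (simp add: power_mult_distrib)
    then show False by presburger
  qed
  show ?thesis
  proof (cases "even n")
    case True
    then obtain k where k: "n = 2 * k" by (elim evenE)
    have oe: "odd e" using True cop by (metis coprime_common_divisor odd_one)
    then obtain j where j: "e\<^sup>2 = 8 * j + 1" by (rule odd_square_int)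
    have q2: "q\<^sup>2 = 4 * (4 * k ^ 4 - 11 * k\<^sup>2 * e\<^sup>2 + 8 * e ^ 4)"
      using eq by (simp add: k power_mult_distrib)
    then have "even (q\<^sup>2)" by simp
    then have "even q" by simp
    then obtain q' where q': "q = 2 * q'" by (elim evenE)
    have eq': "q'\<^sup>2 = 4 * k ^ 4 - 11 * k\<^sup>2 * e\<^sup>2 + 8 * e ^ 4"
      using q2 by (simp add: q' power_mult_distrib)
    have "odd k"
    proof (rule ccontr)
      assume "\<not> odd k"
      then obtain l where l: "k = 2 * l" by (auto elim: evenE)
      have q2': "q'\<^sup>2 = 4 * (16 * l ^ 4 - 11 * l\<^sup>2 * e\<^sup>2 + 2 * e ^ 4)"
        using eq' by (simp add: l power_mult_distrib)
      then have "even (q'\<^sup>2)" by simp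
      then have "even q'" by simp
      then obtain x where x: "q' = 2 * x" by (elim evenE)
      have "x\<^sup>2 = 16 * l ^ 4 - 11 * l\<^sup>2 * e\<^sup>2 + 2 * e ^ 4"
        using q2' by (simp add: x power_mult_distrib)
      then have x2: "x\<^sup>2 = 16 * (l\<^sup>2)\<^sup>2 - 11 * l\<^sup>2 * (8 * j + 1) + 2 * (8 * j + 1)\<^sup>2"
        unfolding fourth_power_eq j .
      show False
      proof (cases "even l")
        case True
        then obtain i where i: "l = 2 * i" by (elim evenE)
        have "x\<^sup>2 = 4 * (64 * (i\<^sup>2)\<^sup>2 - 11 * i\<^sup>2 * (8 * j + 1) + 8 * j + 32 * j\<^sup>2) + 2"
          unfolding x2 by (simp add: i algebra_simps power2_eq_square)
        then show False by (rule sq4)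
      next
        case False
        then obtain i where i: "l\<^sup>2 = 8 * i + 1" by (auto elim: odd_square_int)
        have "x\<^sup>2 = 8 * (2 * (8 * i + 1)\<^sup>2 - 11 * i * (8 * j + 1) - 11 * j + 4 * j + 16 * j\<^sup>2 - 2) + 7"
          unfolding x2 i by algebra
        then show False by (rule sq8)
      qed
    qed
    have "8 * e ^ 4 - 11 * e\<^sup>2 * k\<^sup>2 + 4 * k ^ 4 = q'\<^sup>2" using eq' by simp
    moreover have "coprime e k" using cop by (simp add: k coprime_commute)
    moreover have "k > 0" using assms(3) by (simp add: k)
    ultimately have "e = 1 \<and> k = 1" using quartic_odd_odd oe \<open>odd k\<close> assms(4) by blast
    then show ?thesis by (simp add: k)
  next
    case False
    then obtain i where i: "n\<^sup>2 = 8 * i + 1" by (auto elim: odd_square_int)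
    have "even e"
    proof (rule ccontr)
      assume "odd e"
      then obtain j where j: "e\<^sup>2 = 8 * j + 1" by (rule odd_square_int)
      have "q\<^sup>2 = 4 * (16 * i\<^sup>2 + 4 * i - 176 * i * j - 22 * i - 22 * j + 8 * (8 * j + 1)\<^sup>2 - 3) + 2"
        unfolding eq2 i j by algebra
      then show False by (rule sq4)
    qed
    then show ?thesis using quartic_odd_even[OF eq] False assms by blast
  qed
qed

section \<open>Rational points on the quartic and on the curve of conductor 14\<close>

lemma rat_coprime_fraction:
  fixes x :: rat
  obtains a b where "x = of_int a / of_int b" "b > 0" "coprime a b"
proof -
  obtain a b where ab: "quotient_of x = (a, b)" by (cases "quotient_of x")
  then show ?thesis
    using that quotient_of_div quotient_of_denom_pos quotient_of_coprime by blast
qed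

lemma rat_square_eq_of_int:
  fixes x :: rat
  assumes "x\<^sup>2 = of_int k"
  obtains j where "k = j\<^sup>2"
proof -
  obtain a b where ab: "x = of_int a / of_int b" "b > 0" "coprime a b"
    by (rule rat_coprime_fraction)
  have "(of_int (a\<^sup>2) :: rat) = of_int (k * b\<^sup>2)"
    using assms ab(2) by (simp add: ab(1) power_divide field_simps)
  then have eq: "a\<^sup>2 = k * b\<^sup>2" by (simp only: of_int_eq_iff)
  have "coprime (a\<^sup>2) (b\<^sup>2)" using ab(3) by simp
  moreover have "b\<^sup>2 dvd a\<^sup>2" unfolding eq by simp
  ultimately have "is_unit (b\<^sup>2)" by (meson coprime_common_divisor dvd_refl)
  then have "b\<^sup>2 = 1" by simp
  then show ?thesis using that[of a] eq by simp
qed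

lemma quartic_rat:
  fixes z y :: rat
  assumes "z ^ 4 - 11 * z\<^sup>2 + 32 = y\<^sup>2" "z \<noteq> 0"
  shows "z\<^sup>2 = 4"
proof -
  obtain a e where ae: "z = of_int a / of_int e" "e > 0" "coprime a e"
    by (rule rat_coprime_fraction)
  define n where "n = \<bar>a\<bar>"
  have n: "n > 0" "coprime n e" using assms(2) ae(1,3) by (auto simp: n_def)
  have n2: "n\<^sup>2 = a\<^sup>2" and n4: "n ^ 4 = a ^ 4" by (simp_all add: n_def power_even_abs)
  have "(y * of_int e ^ 2)\<^sup>2 = (z ^ 4 - 11 * z\<^sup>2 + 32) * of_int e ^ 4"
    unfolding assms(1) by (simp add: power_mult_distrib)
  also have "\<dots> = of_int (n ^ 4 - 11 * n\<^sup>2 * e\<^sup>2 + 32 * e ^ 4)"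
    using ae(2) unfolding n2 n4
    by (simp add: ae(1) power_divide field_simps)
  finally obtain q where "n ^ 4 - 11 * n\<^sup>2 * e\<^sup>2 + 32 * e ^ 4 = q\<^sup>2"
    by (rule rat_square_eq_of_int)
  then have "n = 2 \<and> e = 1" using quartic_coprime n ae(2) by blast
  then have "a\<^sup>2 = 4" "e = 1" using n2 by auto
  then show ?thesis by (metis ae(1) div_by_1 of_int_1 of_int_numeral of_int_power)
qed

text \<open>At most the prime 2 is shared by \<open>p\<close> and \<open>K\<close>, so the odd part
  of \<open>p\<close> is a square; the parity of the exponent of 2 decides the case.\<close>

lemma square_up_to_2:
  fixes p K s :: int
  assumes "p * K = s\<^sup>2" "p > 0" "K > 0" and no: "\<And>l. prime l \<Longrightarrow> l \<noteq> 2 \<Longrightarrow> l dvd p \<Longrightarrow> \<not> l dvd K"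
  obtains c where "p = c\<^sup>2 \<or> p = 2 * c\<^sup>2"
proof -
  obtain y where y: "p = y * 2 ^ multiplicity 2 p" "\<not> 2 dvd y"
    by (rule multiplicity_decompose'[of p 2]) (use assms(2) in \<open>auto simp: mult.commute\<close>)
  define j where "j = multiplicity 2 p"
  have p: "p = y * 2 ^ j" using y(1) by (simp add: j_def)
  have y0: "y > 0" using assms(2) unfolding p by (simp add: zero_less_mult_iff)
  have "coprime y (2 ^ j * K)"
  proof (rule int_coprimeI_prime)
    fix l :: int assume l: "prime l" "l dvd y" "l dvd 2 ^ j * K"
    then have l2: "l \<noteq> 2" using y(2) by auto
    then have "l dvd K" using odd_prime_dvd_power2_mult l by blast
    then show False using no[OF l(1) l2] l(2) unfolding p by simp
  qed
  moreover have "2 ^ j * K > 0" using assms(3) by simp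
  moreover have "y * (2 ^ j * K) = s\<^sup>2" using assms(1) by (simp add: p mult_ac)
  ultimately obtain t where t: "y = t\<^sup>2"
    using int_coprime_mult_power[OF _ y0, of "2 ^ j * K" s 2] by auto
  show ?thesis
  proof (cases "even j")
    case True
    then obtain i where "j = 2 * i" by (elim evenE)
    then have "p = (t * 2 ^ i)\<^sup>2" by (simp add: p t power_mult_distrib power_mult[symmetric] mult.commute)
    then show ?thesis using that by blast
  next
    case False
    then obtain i where "j = 2 * i + 1" by (elim oddE)
    then have "p = 2 * (t * 2 ^ i)\<^sup>2" by (simp add: p t power_mult_distrib power_mult[symmetric] mult.commute)
    then show ?thesis using that by blast
  qed
qed

text \<open>This curve has conductor 14; the substitution \<open>x = 4 u\<close> makes it
  \<open>y\<^sup>2 = x (x\<^sup>2 - 11 x + 32)\<close>, on which \<open>x\<close> is a square up to a factor 2, and the two classes are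
  exchanged by \<open>x \<mapsto> 32 / x\<close>, the translation by the point \<open>(0, 0)\<close>.\<close>

lemma elliptic_curve_14a_rat:
  fixes u w :: rat
  assumes uw: "u * (4 * u\<^sup>2 - 11 * u + 8) = w\<^sup>2" and "u \<noteq> 0"
  shows "u = 1 \<or> u = 2"
proof -
  define x where "x = 4 * u"
  have xw: "x * (x\<^sup>2 - 11 * x + 32) = (4 * w)\<^sup>2"
  proof -
    have "x * (x\<^sup>2 - 11 * x + 32) = 16 * (u * (4 * u\<^sup>2 - 11 * u + 8))"
      by (simp add: x_def algebra_simps power2_eq_square)
    then show ?thesis unfolding uw by (simp add: power_mult_distrib)
  qed
  \<comment> \<open>The discriminant 11^2 - 4 * 32 = -7 is negative, so the form is positive
    definite. It is used over the rationals to get \<open>x > 0\<close> and over the integers to get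
    \<open>K > 0\<close>, which removes the sign from the square class of \<open>p\<close>.\<close>
  have quad: "4 * (a\<^sup>2 - 11 * a * b + 32 * b\<^sup>2) = (2 * a - 11 * b)\<^sup>2 + 7 * b\<^sup>2"
    for a b :: "'a :: comm_ring_1"
    by (simp add: algebra_simps power2_eq_square)
  have "4 * (x\<^sup>2 - 11 * x + 32) = (2 * x - 11)\<^sup>2 + 7" using quad[of x 1] by simp
  moreover have "(2 * x - 11)\<^sup>2 \<ge> 0" by (rule zero_le_power2)
  ultimately have "4 * (x\<^sup>2 - 11 * x + 32) > 0" by linarith
  then have "x\<^sup>2 - 11 * x + 32 > 0" by (simp only: zero_less_mult_iff) auto
  moreover have "(4 * w)\<^sup>2 \<ge> 0" by simp
  ultimately have "x \<ge> 0" unfolding xw[symmetric] by (simp add: zero_le_mult_iff)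
  then have x0: "x > 0" using assms(2) by (simp add: x_def)
  obtain p q where pq: "x = of_int p / of_int q" "q > 0" "coprime p q"
    by (rule rat_coprime_fraction)
  have p0: "p > 0" using x0 pq(2) unfolding pq(1) by (simp add: zero_less_divide_iff)
  define K where "K = p\<^sup>2 - 11 * p * q + 32 * q\<^sup>2"
  have "q\<^sup>2 > 0" using pq(2) by simp
  moreover have "(2 * p - 11 * q)\<^sup>2 \<ge> 0" by (rule zero_le_power2)
  ultimately have "4 * K > 0" unfolding K_def quad by linarith
  then have K0: "K > 0" by simp
  have "(4 * w * of_int q ^ 2)\<^sup>2 = x * (x\<^sup>2 - 11 * x + 32) * of_int q ^ 4"
    unfolding xw by (simp add: power_mult_distrib)
  also have "\<dots> = of_int (q * (p * K))"
    using pq(2) by (simp add: pq(1) K_def field_simps power2_eq_square power4_eq_xxxx)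
  finally obtain W where W: "q * (p * K) = W\<^sup>2" by (rule rat_square_eq_of_int)
  have cop: "coprime q (p * K)"
  proof (rule int_coprimeI_prime)
    fix l :: int assume l: "prime l" "l dvd q" "l dvd p * K"
    have nlp: "\<not> l dvd p" using l pq(3) by (meson coprime_common_divisor not_prime_unit)
    then have "l dvd K" using l prime_dvd_multD by blast
    moreover have "p\<^sup>2 = K + (11 * p - 32 * q) * q" by (simp add: K_def algebra_simps power2_eq_square)
    ultimately have "l dvd p\<^sup>2" using l(2) by simp
    then show False using nlp l(1) prime_dvd_power by blast
  qed
  obtain t where t: "q = t\<^sup>2" "t > 0"
    by (rule int_coprime_mult_power[OF cop pq(2) _ W]) (use p0 K0 in simp_all)
  have "p * K * q = W\<^sup>2" using W by (simp add: mult_ac)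
  then obtain s where s: "p * K = s\<^sup>2"
    using int_coprime_mult_power[of "p * K" q W 2] cop p0 K0 pq(2) by (auto simp: coprime_commute)
  obtain c where c: "p = c\<^sup>2 \<or> p = 2 * c\<^sup>2"
  proof (rule square_up_to_2[OF s p0 K0])
    fix l :: int assume l: "prime l" "l \<noteq> 2" "l dvd p"
    show "\<not> l dvd K"
    proof
      assume "l dvd K"
      moreover have "2 ^ 5 * q\<^sup>2 = K - (p - 11 * q) * p" by (simp add: K_def algebra_simps power2_eq_square)
      ultimately have "l dvd 2 ^ 5 * q\<^sup>2" using l(3) by simp
      then have "l dvd q\<^sup>2" using odd_prime_dvd_power2_mult l(1,2) by blast
      then have "l dvd q" using l(1) prime_dvd_power by blast
      then show False using l pq(3) by (meson coprime_common_divisor not_prime_unit)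
    qed
  qed blast
  define z where "z = (of_int c / of_int t :: rat)"
  have z: "x = z\<^sup>2 \<or> x = 2 * z\<^sup>2" using c by (auto simp: pq(1) z_def t(1) power_divide)
  have z0: "z \<noteq> 0" using z x0 by auto
  from z show ?thesis
  proof
    assume x: "x = z\<^sup>2"
    have "z ^ 4 - 11 * z\<^sup>2 + 32 = (4 * w / z)\<^sup>2"
      using xw z0 unfolding x by (simp add: power_divide field_simps)
    then have "z\<^sup>2 = 4" using z0 by (rule quartic_rat)
    then show ?thesis using x by (simp add: x_def)
  next
    assume x: "x = 2 * z\<^sup>2"
    have "4 * z\<^sup>2 * (2 * z ^ 4 - 11 * z\<^sup>2 + 16) = (4 * w)\<^sup>2"
      unfolding xw[symmetric] x by (simp add: algebra_simps power2_eq_square power4_eq_xxxx)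
    \<comment> \<open>Here \<open>32 / x = (4 / z)^2\<close>, so the translate by
      \<open>(0, 0)\<close> lies in the class of squares.\<close>
    then have "(4 / z) ^ 4 - 11 * (4 / z)\<^sup>2 + 32 = (8 * w / z ^ 3)\<^sup>2"
      using z0 by (simp add: field_simps)
    then have "(4 / z)\<^sup>2 = 4" using z0 by (intro quartic_rat) simp_all
    then have "z\<^sup>2 = 4" using z0 by (simp add: field_simps)
    then show ?thesis using x by (simp add: x_def)
  qed
qed

section \<open>Monic factors of degrees 3 and 4, and comparison of coefficients\<close>

lemma irreducible_poly_no_root:
  fixes p :: "rat poly"
  assumes "irreducible p" "degree p \<ge> 2"
  shows "poly p x \<noteq> 0"
proof
  assume "poly p x = 0"
  then obtain q where q: "p = [:- x, 1:] * q" by (auto simp: poly_eq_0_iff_dvd elim: dvdE)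
  have "\<not> is_unit [:- x, 1:]" by (simp add: is_unit_iff_degree)
  then have "is_unit q" using irreducibleD[OF assms(1) q] by blast
  moreover have "q \<noteq> 0" using q assms(2) by auto
  ultimately have "degree q = 0" "q \<noteq> 0" by (simp_all add: is_unit_iff_degree)
  then have "degree p = 1" unfolding q by (subst degree_mult_eq) simp_all
  then show False using assms(2) by simp
qed

lemma monic_cubic_form:
  fixes p :: "rat poly"
  assumes "degree p = 3" "lead_coeff p = 1"
  obtains a b c where "p = [:c, b, a, 1:]"
proof -
  have "p = [:coeff p 0, coeff p 1, coeff p 2, 1:]"
  proof (rule poly_eqI)
    fix n
    show "coeff p n = coeff [:coeff p 0, coeff p 1, coeff p 2, 1:] n"
    proof (cases "n < 4")
      case True
      then have "n = 0 \<or> n = 1 \<or> n = 2 \<or> n = 3" by auto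
      then show ?thesis using assms by (auto simp: numeral_2_eq_2 numeral_3_eq_3)
    next
      case False
      then show ?thesis using assms(1) by (simp add: coeff_eq_0 coeff_pCons split: nat.split)
    qed
  qed
  then show ?thesis using that by blast
qed

lemma monic_quartic_form:
  fixes p :: "rat poly"
  assumes "degree p = 4" "lead_coeff p = 1"
  obtains a d e h where "p = [:h, e, d, a, 1:]"
proof -
  have "p = [:coeff p 0, coeff p 1, coeff p 2, coeff p 3, 1:]"
  proof (rule poly_eqI)
    fix n
    show "coeff p n = coeff [:coeff p 0, coeff p 1, coeff p 2, coeff p 3, 1:] n"
    proof (cases "n < 5")
      case True
      then have "n = 0 \<or> n = 1 \<or> n = 2 \<or> n = 3 \<or> n = 4" by auto
      then show ?thesis using assms by (auto simp: numeral_eq_Suc)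
    next
      case False
      then show ?thesis using assms(1) by (simp add: coeff_eq_0 coeff_pCons split: nat.split)
    qed
  qed
  then show ?thesis using that by blast
qed

text \<open>The given factors need not be monic, but their leading coefficients are inverse to each
  other, so both can be rescaled. Irreducibility is passed on as the absence of rational roots,
  which rules out degenerate solutions later.\<close>

lemma reducibility_type_3_4:
  assumes "has_reducibility_type P [3, 4]"
  obtains a b c a' d e h where "P = [:c, b, a, 1:] * [:h, e, d, a', 1:]"
    "\<And>x. poly [:c, b, a, 1:] x \<noteq> 0" "\<And>x. poly [:h, e, d, a', 1:] x \<noteq> 0"
proof -
  obtain f g where fg: "irreducible f" "irreducible g" "degree f = 3" "degree g = 4" "P = f * g"
    and lc: "lead_coeff P = 1"
    using assms by (auto simp: has_reducibility_type_def map_eq_Cons_conv)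
  define k where "k = lead_coeff f"
  have k: "k \<noteq> 0" using fg(3) unfolding k_def by (metis degree_0 leading_coeff_0_iff zero_neq_numeral)
  have k3: "coeff f 3 = k" using fg(3) by (simp add: k_def)
  have kg: "k * lead_coeff g = 1" using lc by (simp add: fg(5) k_def lead_coeff_mult)
  obtain a b c where f: "smult (inverse k) f = [:c, b, a, 1:]"
    by (rule monic_cubic_form[of "smult (inverse k) f"]) (use fg(3) k in \<open>simp_all add: k3\<close>)
  obtain a' d e h where g: "smult k g = [:h, e, d, a', 1:]"
    by (rule monic_quartic_form[of "smult k g"]) (use fg(4) k kg in simp_all)
  have "P = smult (inverse k) f * smult k g" using k by (simp add: fg(5))
  moreover have "poly (smult (inverse k) f) x \<noteq> 0" "poly (smult k g) x \<noteq> 0" for x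
    using irreducible_poly_no_root[OF fg(1)] irreducible_poly_no_root[OF fg(2)] fg(3,4) k by simp_all
  ultimately show ?thesis using that unfolding f g by blast
qed

lemma trinomial_7_simps:
  "trinomial 7 1 A B = [:B, A, 0, 0, 0, 0, 0, 1:]"
  "trinomial 7 2 A B = [:B, 0, A, 0, 0, 0, 0, 1:]"
  "trinomial 7 3 A B = [:B, 0, 0, A, 0, 0, 0, 1:]"
  by (simp_all add: trinomial_def numeral_eq_Suc monom_Suc monom_0)

lemma cubic_times_quartic:
  "[:c, b, a, 1:] * [:h, e, d, a', 1 :: rat:] =
    [:c * h, b * h + c * e, a * h + b * e + c * d, h + a * e + b * d + c * a',
      e + a * d + b * a' + c, d + a * a' + b, a' + a, 1:]"
  by (simp add: algebra_simps)

text \<open>For \<open>a = 1\<close>, \<open>b = u\<close>, \<open>c = v\<close> the left-hand sides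
  are \<open>h\<close>, \<open>e\<close>, \<open>A\<close> and \<open>B\<close>. Multiplying by
  \<open>2 u - 3\<close> or its square turns each claim into a polynomial identity.\<close>

lemma trinomial_7_1_family:
  fixes u :: rat
  assumes "u \<noteq> 3 / 2"
  defines "v \<equiv> (3 * u - 1) * (u - 1) / (2 * u - 3)"
  shows "1 - 3 * u + u\<^sup>2 + 2 * v = (2 * u - 1) * (u\<^sup>2 - u + 1) / (2 * u - 3)"
    and "2 * u - 1 - v = (u\<^sup>2 - 4 * u + 2) / (2 * u - 3)"
    and "u * (1 - 3 * u + u\<^sup>2 + 2 * v) + v * (2 * u - 1 - v) =
      (4 * u\<^sup>2 - 5 * u + 2) * (u ^ 3 - u\<^sup>2 - 2 * u + 1) / (2 * u - 3)\<^sup>2"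
    and "v * (1 - 3 * u + u\<^sup>2 + 2 * v) =
      (3 * u - 1) * (2 * u - 1) * (u - 1) * (u\<^sup>2 - u + 1) / (2 * u - 3)\<^sup>2"
proof -
  define D where "D = 2 * u - 3"
  have D: "D \<noteq> 0" using assms(1) by (auto simp: D_def field_simps)
  have vD: "v * D = (3 * u - 1) * (u - 1)" using D by (simp add: v_def D_def)
  have h: "(1 - 3 * u + u\<^sup>2 + 2 * v) * D = (2 * u - 1) * (u\<^sup>2 - u + 1)"
  proof -
    have "(1 - 3 * u + u\<^sup>2 + 2 * v) * D = (1 - 3 * u + u\<^sup>2) * D + 2 * (v * D)" by (simp add: algebra_simps)
    then show ?thesis unfolding vD by (simp add: D_def algebra_simps power2_eq_square)
  qed
  have e: "(2 * u - 1 - v) * D = u\<^sup>2 - 4 * u + 2"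
  proof -
    have "(2 * u - 1 - v) * D = (2 * u - 1) * D - v * D" by (simp add: algebra_simps)
    then show ?thesis unfolding vD by (simp add: D_def algebra_simps power2_eq_square)
  qed
  show "1 - 3 * u + u\<^sup>2 + 2 * v = (2 * u - 1) * (u\<^sup>2 - u + 1) / (2 * u - 3)"
    using h D by (simp add: D_def[symmetric] eq_divide_eq)
  show "2 * u - 1 - v = (u\<^sup>2 - 4 * u + 2) / (2 * u - 3)"
    using e D by (simp add: D_def[symmetric] eq_divide_eq)
  have "(u * (1 - 3 * u + u\<^sup>2 + 2 * v) + v * (2 * u - 1 - v)) * D\<^sup>2 =
      u * ((1 - 3 * u + u\<^sup>2 + 2 * v) * D) * D + (v * D) * ((2 * u - 1 - v) * D)"
    by (simp add: algebra_simps power2_eq_square)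
  also have "\<dots> = (4 * u\<^sup>2 - 5 * u + 2) * (u ^ 3 - u\<^sup>2 - 2 * u + 1)"
    unfolding h e vD by (simp add: D_def algebra_simps power2_eq_square power3_eq_cube)
  finally show "u * (1 - 3 * u + u\<^sup>2 + 2 * v) + v * (2 * u - 1 - v) =
      (4 * u\<^sup>2 - 5 * u + 2) * (u ^ 3 - u\<^sup>2 - 2 * u + 1) / (2 * u - 3)\<^sup>2"
    using D by (simp only: D_def[symmetric] eq_divide_eq) simp
  have "v * (1 - 3 * u + u\<^sup>2 + 2 * v) * D\<^sup>2 = (v * D) * ((1 - 3 * u + u\<^sup>2 + 2 * v) * D)"
    by (simp add: algebra_simps power2_eq_square)
  also have "\<dots> = (3 * u - 1) * (2 * u - 1) * (u - 1) * (u\<^sup>2 - u + 1)"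
    unfolding h vD by (simp add: mult_ac)
  finally show "v * (1 - 3 * u + u\<^sup>2 + 2 * v) =
      (3 * u - 1) * (2 * u - 1) * (u - 1) * (u\<^sup>2 - u + 1) / (2 * u - 3)\<^sup>2"
    using D by (simp only: D_def[symmetric] eq_divide_eq) simp
qed

subsection \<open>The three trinomials\<close>

lemma trinomial_7_1_reducible:
  assumes "A * B \<noteq> 0" "has_reducibility_type (trinomial 7 1 A B) [3, 4]"
  shows "\<exists>u. u \<noteq> 1 \<and> u \<noteq> 1/2 \<and> u \<noteq> 1/3 \<and> u \<noteq> 3/2 \<and>
    (let A0 = (4*u^2 - 5*u + 2) * (u^3 - u^2 - 2*u + 1) / (2*u - 3)^2;
         B0 = (3*u - 1) * (2*u - 1) * (u - 1) * (u^2 - u + 1) / (2*u - 3)^2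
     in eq_up_to_scaling 7 1 (A, B) (A0, B0) \<and>
        trinomial 7 1 A0 B0 =
          [:(3*u - 1) * (u - 1) / (2*u - 3), u, 1, 1:] *
          [:(2*u - 1) * (u^2 - u + 1) / (2*u - 3),
            (u^2 - 4*u + 2) / (2*u - 3), -(u - 1), -1, 1:])"
proof -
  obtain a b c a' d e h where "trinomial 7 1 A B = [:c, b, a, 1:] * [:h, e, d, a', 1:]"
    using assms(2) by (rule reducibility_type_3_4)
  then have eqs: "a' + a = 0" "d + a * a' + b = 0" "e + a * d + b * a' + c = 0"
    "h + a * e + b * d + c * a' = 0" "a * h + b * e + c * d = 0" "A = b * h + c * e" "B = c * h"
    unfolding trinomial_7_simps cubic_times_quartic by simp_all
  have a': "a' = - a" using eqs(1) by (simp add: eq_neg_iff_add_eq_0)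
  have d: "d = a\<^sup>2 - b" using eqs(2) unfolding a' by (simp add: power2_eq_square algebra_simps)
  have e: "e = 2 * a * b - a ^ 3 - c" using eqs(3) unfolding a' d
    by (simp add: power2_eq_square power3_eq_cube algebra_simps)
  have h: "h = a ^ 4 - 3 * a\<^sup>2 * b + b\<^sup>2 + 2 * a * c" using eqs(4) unfolding a' d e
    by (simp add: power2_eq_square power3_eq_cube power4_eq_xxxx algebra_simps)
  have c0: "c \<noteq> 0" and h0: "h \<noteq> 0" using assms(1) eqs(7) by auto
  have a0: "a \<noteq> 0"
  proof
    assume "a = 0"
    then have "b = 0" using eqs(5) c0 unfolding d e h by simp
    then show False using h0 \<open>a = 0\<close> by (simp add: h)
  qed
  \<comment> \<open>The scaling that makes \<open>a = 1\<close>: \<open>a\<close>, \<open>b\<close>,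
    \<open>c\<close> have weights 1, 2, 3, and \<open>a\<close> becomes the factor \<open>l\<close>
    of \<open>eq_up_to_scaling\<close>.\<close>
  define u v where "u = b / a\<^sup>2" and "v = c / a ^ 3"
  have b: "b = u * a\<^sup>2" and c: "c = v * a ^ 3" using a0 by (simp_all add: u_def v_def)
  have "a ^ 5 * (1 - 4 * u + 3 * u\<^sup>2 + 3 * v - 2 * u * v) = a * h + b * e + c * d"
    unfolding d e h b c by (simp add: algebra_simps eval_nat_numeral)
  then have "1 - 4 * u + 3 * u\<^sup>2 + 3 * v - 2 * u * v = 0" using eqs(5) a0 by simp
  then have rel: "v * (2 * u - 3) = (3 * u - 1) * (u - 1)" by (simp add: algebra_simps power2_eq_square)
  have u: "u \<noteq> 3 / 2"
  proof
    assume "u = 3 / 2"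
    then show False using rel by (simp only:) simp
  qed
  then have "2 * u - 3 \<noteq> 0" by (auto simp: field_simps)
  then have v: "v = (3 * u - 1) * (u - 1) / (2 * u - 3)" using rel by (simp add: eq_divide_eq)
  note fam = trinomial_7_1_family[OF u, folded v]
  have A: "A = (u * (1 - 3 * u + u\<^sup>2 + 2 * v) + v * (2 * u - 1 - v)) * a ^ 6"
    unfolding eqs(6) h e b c by (simp add: algebra_simps eval_nat_numeral)
  have B: "B = v * (1 - 3 * u + u\<^sup>2 + 2 * v) * a ^ 7"
    unfolding eqs(7) h b c by (simp add: algebra_simps eval_nat_numeral)
  have "B \<noteq> 0" using assms(1) by auto
  then have nu: "u \<noteq> 1" "u \<noteq> 1/2" "u \<noteq> 1/3" unfolding B fam(4) by auto
  have scal: "eq_up_to_scaling 7 1 (A, B)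
      ((4*u^2 - 5*u + 2) * (u^3 - u^2 - 2*u + 1) / (2*u - 3)^2,
       (3*u - 1) * (2*u - 1) * (u - 1) * (u^2 - u + 1) / (2*u - 3)^2)"
    using a0 A B unfolding eq_up_to_scaling_def fam(3,4) by auto
  have tri: "trinomial 7 1 (u * (1 - 3 * u + u\<^sup>2 + 2 * v) + v * (2 * u - 1 - v))
        (v * (1 - 3 * u + u\<^sup>2 + 2 * v)) =
      [:v, u, 1, 1:] * [:1 - 3 * u + u\<^sup>2 + 2 * v, 2 * u - 1 - v, - (u - 1), - 1, 1:]"
    unfolding trinomial_7_simps cubic_times_quartic
    using rel by (simp add: algebra_simps power2_eq_square)
  show ?thesis
    unfolding Let_def using nu u scal tri[unfolded fam(3,4), unfolded fam(1,2), unfolded v]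
    by (intro exI[of _ u] conjI)
qed

lemma trinomial_7_2_not_3_4:
  assumes "A * B \<noteq> 0"
  shows "\<not> has_reducibility_type (trinomial 7 2 A B) [3, 4]"
proof
  assume "has_reducibility_type (trinomial 7 2 A B) [3, 4]"
  then obtain a b c a' d e h where prod: "trinomial 7 2 A B = [:c, b, a, 1:] * [:h, e, d, a', 1:]"
    and root: "\<And>x. poly [:h, e, d, a', 1:] x \<noteq> 0"
    by (rule reducibility_type_3_4) blast
  then have eqs: "a' + a = 0" "d + a * a' + b = 0" "e + a * d + b * a' + c = 0"
    "h + a * e + b * d + c * a' = 0" "b * h + c * e = 0" "B = c * h"
    unfolding trinomial_7_simps cubic_times_quartic by simp_all
  have a': "a' = - a" using eqs(1) by (simp add: eq_neg_iff_add_eq_0)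
  have d: "d = a\<^sup>2 - b" using eqs(2) unfolding a' by (simp add: power2_eq_square algebra_simps)
  have e: "e = 2 * a * b - a ^ 3 - c" using eqs(3) unfolding a' d
    by (simp add: power2_eq_square power3_eq_cube algebra_simps)
  have h: "h = a ^ 4 - 3 * a\<^sup>2 * b + b\<^sup>2 + 2 * a * c" using eqs(4) unfolding a' d e
    by (simp add: power2_eq_square power3_eq_cube power4_eq_xxxx algebra_simps)
  have c0: "c \<noteq> 0" using assms eqs(6) by auto
  txt \<open>For \<open>a = 1\<close> the remaining equation is quadratic in \<open>c\<close>, and the shift \<open>c = v + b\<close> puts it
    into the form \<open>v (v + 1 - 2 b) = b\<^sup>3\<close>.\<close>
  have "(c - a * b) * (- (c - 3 * a * b + a ^ 3)) * a ^ 3 = (- (a * b)) ^ 3"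
  proof -
    have "(c - a * b) * (- (c - 3 * a * b + a ^ 3)) * a ^ 3 - (- (a * b)) ^ 3 = a ^ 3 * (b * h + c * e)"
      unfolding h e by (simp add: algebra_simps eval_nat_numeral)
    then show ?thesis unfolding eqs(5) by simp
  qed
  \<comment> \<open>For \<open>a = 1\<close> the numbers \<open>P\<close>, \<open>Q\<close>,
    \<open>R\<close>, \<open>T\<close> are \<open>v\<close>, \<open>- (v + 1 - 2 b)\<close>, 1 and
    \<open>- b\<close>; powers of \<open>a\<close> make them homogeneous of weight 3, so that
    \<open>a = 0\<close> is covered too.\<close>
  moreover have "(c - a * b) + (- (c - 3 * a * b + a ^ 3)) + a ^ 3 = - 2 * (- (a * b))" by simp
  ultimately have "- (a * b) = 0" by (rule no_product_sum_cube_rat)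
  then consider "a = 0" | "a \<noteq> 0" "b = 0" by auto
  then show False
  proof cases
    case 1
    \<comment> \<open>The curve degenerates to a cusp, parametrized by \<open>t = c / b\<close>, and
      this \<open>t\<close> is a root of the quartic factor.\<close>
    have bc: "b ^ 3 = c\<^sup>2" using eqs(5) unfolding h e 1 by (simp add: power2_eq_square power3_eq_cube)
    then have b0: "b \<noteq> 0" using c0 by auto
    define t where "t = c / b"
    have c: "c = t * b" using b0 by (simp add: t_def)
    have "b * b\<^sup>2 = t\<^sup>2 * b\<^sup>2" using bc unfolding c by (simp add: power2_eq_square power3_eq_cube mult_ac)
    then have b: "b = t\<^sup>2" using b0 by simp
    have "poly [:h, e, d, a', 1:] t = 0"
      unfolding h e d a' 1 c b by (simp add: algebra_simps eval_nat_numeral)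
    then show False using root by blast
  next
    case 2
    have "c * (c + a ^ 3) = 0" using eqs(5) unfolding h e 2 by (simp add: algebra_simps)
    then have c: "c = - (a ^ 3)" using c0 by (simp add: eq_neg_iff_add_eq_0)
    have "poly [:h, e, d, a', 1:] a = 0"
      unfolding h e d a' 2 c by (simp add: algebra_simps eval_nat_numeral)
    then show False using root by blast
  qed
qed

lemma trinomial_7_3_reducible:
  assumes "A * B \<noteq> 0" "has_reducibility_type (trinomial 7 3 A B) [3, 4]"
  shows "eq_up_to_scaling 7 3 (A, B) (2, - 1)"
proof -
  obtain a b c a' d e h where prod: "trinomial 7 3 A B = [:c, b, a, 1:] * [:h, e, d, a', 1:]"
    and root: "\<And>x. poly [:c, b, a, 1:] x \<noteq> 0"
    using assms(2) by (rule reducibility_type_3_4) blast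
  then have eqs: "a' + a = 0" "d + a * a' + b = 0" "e + a * d + b * a' + c = 0"
    "A = h + a * e + b * d + c * a'" "a * h + b * e + c * d = 0" "b * h + c * e = 0" "B = c * h"
    unfolding trinomial_7_simps cubic_times_quartic by simp_all
  have a': "a' = - a" using eqs(1) by (simp add: eq_neg_iff_add_eq_0)
  have d: "d = a\<^sup>2 - b" using eqs(2) unfolding a' by (simp add: power2_eq_square algebra_simps)
  have e: "e = 2 * a * b - a ^ 3 - c" using eqs(3) unfolding a' d
    by (simp add: power2_eq_square power3_eq_cube algebra_simps)
  have c0: "c \<noteq> 0" using assms(1) eqs(7) by auto
  have a0: "a \<noteq> 0"
  proof
    assume a: "a = 0"
    then have "b = 0" using eqs(5) c0 unfolding d e by simp
    then show False using eqs(6) c0 a unfolding e by simp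
  qed
  define u v k where "u = b / a\<^sup>2" and "v = c / a ^ 3" and "k = h / a ^ 4"
  have b: "b = u * a\<^sup>2" and c: "c = v * a ^ 3" and h: "h = k * a ^ 4"
    using a0 by (simp_all add: u_def v_def k_def)
  have v0: "v \<noteq> 0" using c0 c by auto
  have "a ^ 5 * (k + u * (2 * u - 1 - v) + v * (1 - u)) = a * h + b * e + c * d"
    unfolding d e h b c by (simp add: algebra_simps eval_nat_numeral)
  then have "k + u * (2 * u - 1 - v) + v * (1 - u) = 0" using eqs(5) a0 by simp
  then have k: "k = - (u * (2 * u - 1 - v) + v * (1 - u))" by linarith
  have "a ^ 6 * (u * k + v * (2 * u - 1 - v)) = b * h + c * e"
    unfolding e h b c by (simp add: algebra_simps eval_nat_numeral)
  then have uv: "u * k + v * (2 * u - 1 - v) = 0" using eqs(6) a0 by simp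
  txt \<open>The discriminant of the quadratic equation \<open>uv\<close> for \<open>v\<close> is a square.\<close>
  have quartic: "(u - 1) * (2 * u - 1) * (2 * u\<^sup>2 + u + 1) = (2 * v + 1 - u - 2 * u\<^sup>2)\<^sup>2"
  proof -
    have "(u - 1) * (2 * u - 1) * (2 * u\<^sup>2 + u + 1) - (2 * v + 1 - u - 2 * u\<^sup>2)\<^sup>2
        = 4 * (u * k + v * (2 * u - 1 - v))"
      unfolding k by (simp add: algebra_simps power2_eq_square)
    then show ?thesis unfolding uv by simp
  qed
  \<comment> \<open>The point \<open>u = v = 1\<close> belongs to the cubic
    \<open>x^3 + a x^2 + a^2 x + a^3\<close>, which has the root \<open>- a\<close>.\<close>
  have u1: "u \<noteq> 1"
  proof
    assume u: "u = 1"
    then have "v = 1" using quartic by simp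
    then have "poly [:c, b, a, 1:] (- a) = 0"
      unfolding b c u by (simp add: algebra_simps eval_nat_numeral)
    then show False using root by blast
  qed
  \<comment> \<open>This sends the rational branch points \<open>u = 1\<close> and
    \<open>u = 1 / 2\<close> to infinity and 0, which turns the quartic model into a cubic
    one.\<close>
  define w where "w = (2 * u - 1) / (u - 1)"
  define y where "y = (2 * v + 1 - u - 2 * u\<^sup>2) / (u - 1)\<^sup>2"
  have U: "u - 1 \<noteq> 0" using u1 by simp
  have w1: "w * (u - 1) = 2 * u - 1" using U by (simp add: w_def)
  have "w * (4 * w\<^sup>2 - 11 * w + 8) * (u - 1) ^ 4 =
      (w * (u - 1)) * (u - 1) * (4 * (w * (u - 1))\<^sup>2 - 11 * (w * (u - 1)) * (u - 1) + 8 * (u - 1)\<^sup>2)"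
    by (simp add: algebra_simps eval_nat_numeral)
  also have "\<dots> = (u - 1) * (2 * u - 1) * (2 * u\<^sup>2 + u + 1)"
    unfolding w1 by (simp add: algebra_simps power2_eq_square)
  also have "\<dots> = y\<^sup>2 * (u - 1) ^ 4"
    unfolding quartic using U by (simp add: y_def power_divide power_mult[symmetric])
  finally have wy: "w * (4 * w\<^sup>2 - 11 * w + 8) = y\<^sup>2" using U by simp
  have "w \<noteq> 0"
  proof
    assume "w = 0"
    then have u: "u = 1 / 2" using w1 by simp
    then have "v = 0" using quartic by (simp add: power2_eq_square field_simps)
    then show False using v0 by simp
  qed
  with wy have "w = 1 \<or> w = 2" by (rule elliptic_curve_14a_rat)
  \<comment> \<open>\<open>w = 2\<close> corresponds to infinite \<open>u\<close>, so
    \<open>w = 1\<close> is left.\<close>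
  then have u: "u = 0" using w1 by auto
  have "v * (v + 1) = 0" using uv unfolding k u by (simp add: algebra_simps)
  then have v: "v = - 1" using v0 by (simp add: eq_neg_iff_add_eq_0)
  have "A = 2 * a ^ 4" "B = - 1 * a ^ 7"
    unfolding eqs(4,7) a' d e h b c k u v by (simp_all add: algebra_simps eval_nat_numeral)
  then show ?thesis using a0 unfolding eq_up_to_scaling_def by auto
qed

theorem theorem5p3:
  fixes A B :: rat
  assumes "A * B \<noteq> 0"
  shows "(has_reducibility_type (trinomial 7 1 A B) [3, 4] \<longrightarrow>
           (\<exists>u::rat. u \<noteq> 1 \<and> u \<noteq> 1/2 \<and> u \<noteq> 1/3 \<and> u \<noteq> 3/2 \<and>
             (let A0 = (4*u^2 - 5*u + 2) * (u^3 - u^2 - 2*u + 1) / (2*u - 3)^2;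
                  B0 = (3*u - 1) * (2*u - 1) * (u - 1) * (u^2 - u + 1) / (2*u - 3)^2
              in eq_up_to_scaling 7 1 (A, B) (A0, B0) \<and>
                 trinomial 7 1 A0 B0 =
                   [:(3*u - 1) * (u - 1) / (2*u - 3), u, 1, 1:] *
                   [:(2*u - 1) * (u^2 - u + 1) / (2*u - 3),
                     (u^2 - 4*u + 2) / (2*u - 3), -(u - 1), -1, 1:])))
       \<and> \<not> has_reducibility_type (trinomial 7 2 A B) [3, 4]
       \<and> (has_reducibility_type (trinomial 7 3 A B) [3, 4] \<longrightarrow>
           eq_up_to_scaling 7 3 (A, B) (2, -1) \<and>
           trinomial 7 3 2 (-1) = [:-1, 0, 1, 1:] * [:1, 0, 1, -1, 1:])"
  using trinomial_7_1_reducible[OF assms] trinomial_7_2_not_3_4[OF assms]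
    trinomial_7_3_reducible[OF assms]
  by (auto simp: trinomial_7_simps cubic_times_quartic)

end
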